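(* Let $\mathbb{A}\subseteq \mathbb{R}\times E^{[\infty]}$ be analytic. Then there are a nonempty perfect set $P\subseteq\mathbb{R}$ and an $X\in E^{[\infty]}$ such that either (i) player I has a strategy $\sigma$ in the asymptotic game $F[X]$ such that $P\times[\sigma]\subseteq(\mathbb{R}\times E^{[\infty]})\setminus\mathbb{A}$, or (ii) for every $t\in P$, player II has a strategy in the Gowers game $G[X]$ for playing into $\mathbb{A}_t=\{Y\in E^{[\infty]}:(t,Y)\in\mathbb{A}\}$.
   Context: $F$ is a countable (possibly finite) field and $E$ is a countably infinite-dimensional $F$-vector space with a fixed basis $(e_n)_{n\in\omega}$. The support $\mathrm{supp}(v)$ of a nonzero $v\in E$ is the finite set of $i$ such that $e_i$ has nonzero coefficient in $v$. A block sequence is a sequence $(x_n)$ of nonzero vectors with $\max\mathrm{supp}(x_n)<\min\mathrm{supp}(x_{n+1})$ for all $n$. $E^{[\infty]}$ is the set of infinite block sequences, topologized as a subspace of $E^\omega$ ($E$ discrete), a Polish space. $\langle X\rangle$ is the linear span of $X$; $Y\preceq X$ means $\langle Y\rangle\subseteq\langle X\rangle$. Asymptotic game $F[X]$ ($X\in E^{[\infty]}$): I plays natural numbers $n_k$, II responds with nonzero $y_k\in\langle X\rangle$ with $n_k<\min\mathrm{supp}(y_k)$, and II's moves must form a block sequence; the outcome is $(y_k)$. Gowers game $G[X]$: I plays $Y_k\in E^{[\infty]}$ with $Y_k\preceq X$, II responds with nonzero $y_k\in\langle Y_k\rangle$, II's moves forming a block sequence; outcome $(y_k)$. A strategy for a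 player is a function from finite sequences of the opponent's previous moves to moves. A player has a strategy for playing into (out of) a set $\mathbb{B}\subseteq E^{[\infty]}$ if all outcomes of plays following the strategy lie in (outside) $\mathbb{B}$. For a strategy $\sigma$ of I, $[\sigma]$ is the set of all outcomes of plays in which I follows $\sigma$. *)

theory Defs
  imports "HOL-Analysis.Analysis" "HOL-Library.Countable" "HOL-Library.Function_Algebras"
begin

text \<open>Vectors of E are finitely supported functions nat => 'f (coefficients w.r.t. the basis e_n).\<close>

definition supp :: "(nat \<Rightarrow> 'f::zero) \<Rightarrow> nat set" where
  "supp v = {i. v i \<noteq> 0}"

definition Evec :: "(nat \<Rightarrow> 'f::zero) set" where
  "Evec = {v. finite (supp v)}"

definition lspan :: "(nat \<Rightarrow> 'f::field) set \<Rightarrow> (nat \<Rightarrow> 'f) set" where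
  "lspan S = module.span (\<lambda>c v i. c * v i) S"

definition BlockSeqs :: "(nat \<Rightarrow> nat \<Rightarrow> 'f::zero) set" where
  "BlockSeqs = {x. (\<forall>n. x n \<in> Evec \<and> x n \<noteq> 0) \<and>
                   (\<forall>n. Max (supp (x n)) < Min (supp (x (Suc n))))}"

definition bspan :: "(nat \<Rightarrow> nat \<Rightarrow> 'f::field) \<Rightarrow> (nat \<Rightarrow> 'f) set" where
  "bspan X = lspan (range X)"

definition below :: "(nat \<Rightarrow> nat \<Rightarrow> 'f::field) \<Rightarrow> (nat \<Rightarrow> nat \<Rightarrow> 'f) \<Rightarrow> bool" where
  "below Y X \<longleftrightarrow> bspan Y \<subseteq> bspan X"

definition block_top :: "(nat \<Rightarrow> nat \<Rightarrow> 'f::zero) topology" where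
  "block_top = subtopology (product_topology (\<lambda>_. discrete_topology Evec) UNIV) BlockSeqs"

definition baire_top :: "(nat \<Rightarrow> nat) topology" where
  "baire_top = product_topology (\<lambda>_. discrete_topology UNIV) UNIV"

definition analytic_in :: "'a topology \<Rightarrow> 'a set \<Rightarrow> bool" where
  "analytic_in T A \<longleftrightarrow> A = {} \<or> (\<exists>f. continuous_map baire_top T f \<and> f ` UNIV = A)"

definition perfect_real :: "real set \<Rightarrow> bool" where
  "perfect_real P \<longleftrightarrow> closed P \<and> (\<forall>x\<in>P. x islimpt P)"

text \<open>Outcomes [sigma] of the asymptotic game F[X] when I follows sigma
  (sigma maps the finite sequence of II's previous moves to a natural number).\<close>
definition asym_outcomes ::
  "(nat \<Rightarrow> nat \<Rightarrow> 'f::field) \<Rightarrow> ((nat \<Rightarrow> 'f) list \<Rightarrow> nat) \<Rightarrow> (nat \<Rightarrow> nat \<Rightarrow> 'f) set" where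
  "asym_outcomes X \<sigma> = {y \<in> BlockSeqs. \<forall>k. y k \<in> bspan X \<and>
        \<sigma> (map y [0..<k]) < Min (supp (y k))}"

text \<open>tau is a strategy for II in the Gowers game G[X] playing into B
  (tau maps the finite sequence of I's moves so far, including the current one, to II's answer).\<close>
definition gowers_II_into ::
  "(nat \<Rightarrow> nat \<Rightarrow> 'f::field) \<Rightarrow> ((nat \<Rightarrow> nat \<Rightarrow> 'f) list \<Rightarrow> (nat \<Rightarrow> 'f)) \<Rightarrow> (nat \<Rightarrow> nat \<Rightarrow> 'f) set \<Rightarrow> bool" where
  "gowers_II_into X \<tau> B \<longleftrightarrow>
    (\<forall>Ys. (\<forall>k. Ys k \<in> BlockSeqs \<and> below (Ys k) X) \<longrightarrow>
      (let y = (\<lambda>k. \<tau> (map Ys [0..<Suc k])) in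
        (\<forall>k. y k \<in> bspan (Ys k) \<and> y k \<noteq> 0) \<and> y \<in> BlockSeqs \<and> y \<in> B))"

end

theory Submission
  imports Defs
begin

text \<open>
  Code the analytic set as the range of a continuous \<open>f\<close> on Baire space, and work with conditions
  \<open>(Q, X)\<close>, \<open>Q\<close> a compact perfect set of parameters and \<open>X\<close> a block sequence. Call \<open>(xs, u)\<close> won
  on \<open>(Q, X)\<close> if from position \<open>xs\<close> player I has one strategy that, for all \<open>t\<close> in \<open>Q\<close>, avoids
  the image of the cylinder of \<open>u\<close>. A fusion decides locally, for all \<open>(xs, u)\<close>, whether it is won
  or is won on no smaller condition. If it is never won near \<open>t\<close>, then II can reach from \<open>xs\<close> some
  \<open>ys\<close> at which \<open>(ys, u @ [m])\<close> is again never won near \<open>t\<close> for some \<open>m\<close>: otherwise I merges the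
  strategies against all \<open>m\<close>. Iterating, II builds a witness of membership digit by digit.

  The passage from one \<open>t\<close> to a perfect set rests on the case of a single move: given an open
  relation between parameters and vectors, either some block subspace avoids the relation for a
  perfect set of parameters, or below some \<open>X\<close> all but countably many parameters meet every subspace.
\<close>

section \<open>Block sequences modulo finite\<close>

text \<open>The obstacle is uniformity: player I needs one strategy for a whole perfect set, while
  II may use a different one for each parameter. Moves of I are numbers, so finitely many strategies
  of I combine by taking maxima, and compactness of \<open>Q\<close> makes local wins global.
  Infinitely many digits \<open>m\<close> cannot be handled by one maximum, but a strategy against
  \<open>m\<close> need only start at a late position. On the side of II, failures are confined to
  countably many parameters: there are only countably many positions, digit strings and basic open
  sets, so the exceptional sets add up to a countable set, which some perfect subset avoids.
  Descending sequences of block sequences have lower bounds only modulo finite. This harms neither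
  player: I excludes the error by playing above a threshold, and the reachability relation for II
  already grants I every subspace almost below \<open>X\<close>. "Never won" has to speak of all
  smaller conditions, since the mere absence of a win is not inherited when the condition
  shrinks.\<close>

interpretation fun_space: vector_space "\<lambda>c (v::nat \<Rightarrow> 'f::field) i. c * v i"
  by unfold_locales (auto simp: fun_eq_iff algebra_simps)

lemma lspan_eq_span: "lspan S = fun_space.span S"
  by (simp add: lspan_def)

text \<open>A linear form of \<open>n < Min (supp v)\<close>: it holds for 0 as well and cuts out a
  subspace, so it passes from generators to spans.\<close>

definition above :: "nat \<Rightarrow> (nat \<Rightarrow> 'f::zero) \<Rightarrow> bool" where
  "above n v \<longleftrightarrow> (\<forall>i\<le>n. v i = 0)"

lemma above_mono: "above n v \<Longrightarrow> m \<le> n \<Longrightarrow> above m v"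
  by (auto simp: above_def)

lemma subspace_above: "fun_space.subspace {v::nat \<Rightarrow> 'f::field. above n v}"
  by (auto simp: fun_space.subspace_def above_def)

lemma subspace_Evec: "fun_space.subspace (Evec :: (nat \<Rightarrow> 'f::field) set)"
proof -
  have "finite (supp (x + y))" if "finite (supp x)" "finite (supp y)" for x y :: "nat \<Rightarrow> 'f"
    by (rule finite_subset[of _ "supp x \<union> supp y"]) (use that in \<open>auto simp: supp_def\<close>)
  moreover have "finite (supp (\<lambda>i. c * x i))" if "finite (supp x)" for c and x :: "nat \<Rightarrow> 'f"
    by (rule finite_subset[of _ "supp x"]) (use that in \<open>auto simp: supp_def\<close>)
  ultimately show ?thesis
    by (auto simp: fun_space.subspace_def Evec_def) (simp add: supp_def)
qed

lemma supp_nonempty: "v \<noteq> 0 \<Longrightarrow> supp v \<noteq> {}"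
  by (auto simp: supp_def fun_eq_iff)

lemma above_iff_less_Min:
  assumes "v \<in> Evec" "v \<noteq> 0"
  shows "above n v \<longleftrightarrow> n < Min (supp v)"
  using assms supp_nonempty[OF assms(2)]
  by (subst Min_gr_iff) (force simp: above_def Evec_def supp_def not_le)+

lemma Max_supp_less_Min_supp_iff:
  assumes "v \<in> Evec" "v \<noteq> 0" "w \<in> Evec" "w \<noteq> 0"
  shows "Max (supp v) < Min (supp w) \<longleftrightarrow> above (Max (supp v)) w"
  using above_iff_less_Min[OF assms(3,4)] by simp

lemma above_Max_supp:
  assumes "v \<in> Evec" "above n v" "v \<noteq> 0"
  shows "n < Max (supp v)"
  using assms above_iff_less_Min[of v n] supp_nonempty[of v]
  by (metis Evec_def Max_in Min_le less_le_trans mem_Collect_eq)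

lemma BlockSeqs_iff:
  "x \<in> BlockSeqs \<longleftrightarrow>
    (\<forall>n. x n \<in> Evec \<and> x n \<noteq> 0) \<and> (\<forall>n. above (Max (supp (x n))) (x (Suc n)))"
  using Max_supp_less_Min_supp_iff by (fastforce simp: BlockSeqs_def)

lemma BlockSeqsD:
  assumes "x \<in> BlockSeqs"
  shows "x n \<in> Evec" "x n \<noteq> 0" "above (Max (supp (x n))) (x (Suc n))"
  using assms by (auto simp: BlockSeqs_iff)

lemma BlockSeqs_above_Max:
  assumes X: "X \<in> BlockSeqs" and "i < j"
  shows "above (Max (supp (X i))) (X j)"
  using \<open>i < j\<close>
proof (induction j)
  case (Suc j)
  then consider "i = j" | "i < j" by linarith
  then show ?case
  proof cases
    case 2
    then have "Max (supp (X i)) < Max (supp (X j))"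
      using Suc.IH above_Max_supp BlockSeqsD[OF X] by blast
    then show ?thesis
      using BlockSeqsD(3)[OF X, of j] above_mono by fastforce
  qed (use BlockSeqsD(3)[OF X] in blast)
qed simp

lemma BlockSeqs_above:
  assumes X: "X \<in> BlockSeqs"
  shows "n < i \<Longrightarrow> above n (X i)"
proof -
  have *: "n \<le> Max (supp (X n))" for n
  proof (induction n)
    case (Suc n)
    then show ?case
      using above_Max_supp[OF BlockSeqsD(1)[OF X] BlockSeqsD(3)[OF X] BlockSeqsD(2)[OF X], of n]
      by linarith
  qed simp
  show "n < i \<Longrightarrow> above n (X i)"
    using BlockSeqs_above_Max[OF X] * above_mono by blast
qed

section \<open>Tails of block sequences and their spans\<close>

definition shift :: "nat \<Rightarrow> (nat \<Rightarrow> 'a) \<Rightarrow> nat \<Rightarrow> 'a" where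
  "shift m X = (\<lambda>i. X (i + m))"

lemma shift_BlockSeqs [simp]: "X \<in> BlockSeqs \<Longrightarrow> shift m X \<in> BlockSeqs"
  by (simp add: BlockSeqs_iff shift_def)

lemma bspan_subset: "range X \<subseteq> bspan Y \<Longrightarrow> bspan X \<subseteq> bspan Y"
  unfolding bspan_def lspan_eq_span
  by (metis fun_space.span_mono fun_space.span_span)

lemma in_bspan [simp]: "X i \<in> bspan X"
  unfolding bspan_def lspan_eq_span by (auto intro: fun_space.span_base)

lemma bspan_shift: "bspan (shift m X) \<subseteq> bspan X"
  by (rule bspan_subset) (auto simp: shift_def)

lemma bspan_Evec: "X \<in> BlockSeqs \<Longrightarrow> bspan X \<subseteq> Evec"
  unfolding bspan_def lspan_eq_span
  by (rule fun_space.span_minimal) (auto simp: BlockSeqs_iff subspace_Evec)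

lemma bspan_above:
  assumes "\<And>i. above n (X i)" "y \<in> bspan X"
  shows "above n y"
proof -
  have "bspan X \<subseteq> {v. above n v}"
    unfolding bspan_def lspan_eq_span
    by (rule fun_space.span_minimal) (use assms subspace_above in auto)
  then show ?thesis using assms by auto
qed

lemma bspan_shift_above:
  assumes "X \<in> BlockSeqs" "y \<in> bspan (shift (Suc n) X)"
  shows "above n y"
  by (rule bspan_above[OF _ assms(2)]) (simp add: shift_def BlockSeqs_above[OF assms(1)])

lemma bspan_shift_above_Max:
  assumes "X \<in> BlockSeqs" "y \<in> bspan (shift (Suc n) X)"
  shows "above (Max (supp (X n))) y"
  by (rule bspan_above[OF _ assms(2)]) (simp add: shift_def BlockSeqs_above_Max[OF assms(1)])

text \<open>Split \<open>y\<close> into a combination \<open>a\<close> of the first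
  \<open>n + 1\<close> terms and a combination \<open>b\<close> of the later ones. Both
  \<open>y\<close> and \<open>b\<close> vanish up to \<open>Max (supp (X n))\<close>, and
  \<open>a\<close> vanishes beyond it, so \<open>a = y - b\<close> is 0.\<close>

lemma above_bspan_shift:
  assumes X: "X \<in> BlockSeqs" and y: "y \<in> bspan X" "above (Max (supp (X n))) y"
  shows "y \<in> bspan (shift (Suc n) X)"
proof -
  let ?m = "Max (supp (X n))"
  have "range X = X ` {..n} \<union> range (shift (Suc n) X)"
  proof -
    have "X i \<in> X ` {..n} \<union> range (shift (Suc n) X)" for i
    proof (cases "i \<le> n")
      case False
      then have "X i = shift (Suc n) X (i - Suc n)" by (simp add: shift_def)
      then show ?thesis by blast
    qed blast
    moreover have "range (shift (Suc n) X) \<subseteq> range X" by (auto simp: shift_def)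
    ultimately show ?thesis by blast
  qed
  then obtain a b where ab: "y = a + b" "a \<in> fun_space.span (X ` {..n})" "b \<in> bspan (shift (Suc n) X)"
    using y(1) unfolding bspan_def lspan_eq_span by (auto simp: fun_space.span_Un)
  have b: "above ?m b" using bspan_shift_above_Max[OF X ab(3)] .
  let ?S = "{v::nat \<Rightarrow> 'a. \<forall>i>?m. v i = 0}"
  have "fun_space.subspace ?S" by (auto simp: fun_space.subspace_def)
  moreover have "X i \<in> ?S" if "i \<le> n" for i
  proof -
    have fin: "finite (supp (X i))" using BlockSeqsD(1)[OF X] by (auto simp: Evec_def)
    have "Max (supp (X i)) \<le> ?m"
    proof (cases "i = n")
      case False
      with that have "i < n" by simp
      then show ?thesis
        using above_Max_supp[OF BlockSeqsD(1)[OF X] BlockSeqs_above_Max[OF X] BlockSeqsD(2)[OF X]]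
        by (simp add: less_imp_le)
    qed simp
    then have "X i j = 0" if "j > ?m" for j
      using Max_ge[OF fin, of j] that by (cases "X i j = 0") (simp_all add: supp_def)
    then show ?thesis by blast
  qed
  ultimately have "a \<in> ?S"
    using ab(2) fun_space.span_minimal[of "X ` {..n}" ?S] by auto
  moreover have "above ?m a"
    using b y(2) ab(1) by (auto simp: above_def)
  ultimately have "a i = 0" for i
    by (cases "i \<le> ?m") (simp_all add: above_def)
  then have "a = 0" by (simp add: fun_eq_iff)
  then show ?thesis using ab by simp
qed

text \<open>The order modulo finite. It uses a threshold on vectors rather than a tail of
  \<open>Y\<close>, because a threshold is exactly what player I can enforce in the asymptotic
  game.\<close>

definition alm :: "(nat \<Rightarrow> nat \<Rightarrow> 'f::field) \<Rightarrow> (nat \<Rightarrow> nat \<Rightarrow> 'f) \<Rightarrow> bool" where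
  "alm Y X \<longleftrightarrow> (\<exists>n. \<forall>y\<in>bspan Y. above n y \<longrightarrow> y \<in> bspan X)"

lemma alm_refl [simp]: "alm X X"
  by (auto simp: alm_def)

lemma alm_trans [trans]:
  assumes "alm X Y" "alm Y Z"
  shows "alm X Z"
proof -
  obtain n m where "\<forall>y\<in>bspan X. above n y \<longrightarrow> y \<in> bspan Y" "\<forall>y\<in>bspan Y. above m y \<longrightarrow> y \<in> bspan Z"
    using assms by (auto simp: alm_def)
  then show ?thesis
    unfolding alm_def by (intro exI[of _ "max n m"]) (meson above_mono max.cobounded1 max.cobounded2)
qed

lemma below_imp_alm: "below Y X \<Longrightarrow> alm Y X"
  by (auto simp: alm_def below_def)

lemma below_shift [simp]: "below (shift m X) X"
  by (simp add: below_def bspan_shift)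

lemma alm_imp_below_shift:
  assumes "alm Y X" "Y \<in> BlockSeqs"
  obtains m where "below (shift m Y) X"
proof -
  obtain n where "\<forall>y\<in>bspan Y. above n y \<longrightarrow> y \<in> bspan X"
    using assms by (auto simp: alm_def)
  then have "below (shift (Suc n) Y) X"
    using bspan_shift_above[OF assms(2)] bspan_shift unfolding below_def by blast
  then show thesis using that by blast
qed

text \<open>Diagonalization: \<open>Y k\<close> is taken in \<open>bspan (X k)\<close> beyond a
  threshold \<open>N k\<close> past which \<open>bspan (X k)\<close> lies in
  \<open>bspan (X j)\<close> for all \<open>j \<le> k\<close> at once. So all terms of
  \<open>Y\<close> from index \<open>k\<close> on lie in \<open>bspan (X k)\<close>.\<close>

lemma pseudo_intersection:
  assumes X: "\<And>k. X k \<in> BlockSeqs" and step: "\<And>k. alm (X (Suc k)) (X k)"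
  obtains Y where "Y \<in> BlockSeqs" "\<And>k. alm Y (X k)"
proof -
  have alm: "alm (X k) (X j)" if "j \<le> k" for j k
    using that by (induction k rule: dec_induct) (auto intro: alm_trans step)
  have "\<exists>n. \<forall>j\<le>k. \<forall>y\<in>bspan (X k). above n y \<longrightarrow> y \<in> bspan (X j)" for k
  proof -
    have "\<forall>j. \<exists>n. j \<le> k \<longrightarrow> (\<forall>y\<in>bspan (X k). above n y \<longrightarrow> y \<in> bspan (X j))"
      using alm by (auto simp: alm_def)
    then obtain g where g: "\<And>j. j \<le> k \<Longrightarrow> (\<forall>y\<in>bspan (X k). above (g j) y \<longrightarrow> y \<in> bspan (X j))"
      by metis
    have "g j \<le> Max (g ` {..k})" if "j \<le> k" for j using that by auto
    then show ?thesis
      using g above_mono by (intro exI[of _ "Max (g ` {..k})"]) blast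
  qed
  then obtain N where N: "\<And>k j y. j \<le> k \<Longrightarrow> y \<in> bspan (X k) \<Longrightarrow> above (N k) y \<Longrightarrow> y \<in> bspan (X j)"
    by metis
  have ex: "\<exists>y. y \<in> bspan (X k) \<and> y \<in> Evec \<and> y \<noteq> 0 \<and> above (N k) y \<and> above n y" for k n
  proof -
    let ?y = "X k (Suc (max (N k) n))"
    have "above (N k) ?y" "above n ?y" by (rule BlockSeqs_above[OF X]; simp)+
    then show ?thesis using BlockSeqsD[OF X] in_bspan by blast
  qed
  have "\<exists>Y. \<forall>k. (Y k \<in> bspan (X k) \<and> Y k \<in> Evec \<and> Y k \<noteq> 0 \<and> above (N k) (Y k)) \<and>
      above (Max (supp (Y k))) (Y (Suc k))"
    by (rule dependent_nat_choice) (use ex in blast)+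
  then obtain Y where Y: "\<And>k. Y k \<in> bspan (X k)" "\<And>k. Y k \<in> Evec" "\<And>k. Y k \<noteq> 0"
     "\<And>k. above (N k) (Y k)" "\<And>k. above (Max (supp (Y k))) (Y (Suc k))"
    by blast
  have YB: "Y \<in> BlockSeqs" using Y by (simp add: BlockSeqs_iff)
  have "alm Y (X k)" for k
  proof -
    have "Y (i + Suc k) \<in> bspan (X k)" for i
      by (rule N[of _ "i + Suc k"]) (use Y in auto)
    then have "bspan (shift (Suc k) Y) \<subseteq> bspan (X k)"
      by (intro bspan_subset) (auto simp: shift_def)
    then show ?thesis
      using above_bspan_shift[OF YB] unfolding alm_def by blast
  qed
  then show thesis using that YB by blast
qed

text \<open>Finite lists of coefficients code the finitely supported vectors; countability of the
  field enters here.\<close>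

lemma countable_Evec: "countable (Evec :: (nat \<Rightarrow> 'f::{zero,countable}) set)"
proof -
  let ?g = "\<lambda>l::'f list. \<lambda>i. if i < length l then l ! i else 0"
  have "v \<in> range ?g" if v: "v \<in> Evec" for v :: "nat \<Rightarrow> 'f"
  proof -
    obtain n where n: "\<forall>i\<in>supp v. i < n"
      using v finite_nat_set_iff_bounded[of "supp v"] by (auto simp: Evec_def)
    have "v = ?g (map v [0..<n])"
      using n by (auto simp: fun_eq_iff supp_def)
    then show ?thesis by blast
  qed
  then have "Evec \<subseteq> range ?g" by blast
  then show ?thesis by (rule countable_subset) simp
qed

lemma BlockSeqs_nonempty: "\<exists>X::nat \<Rightarrow> nat \<Rightarrow> 'f::field. X \<in> BlockSeqs"
proof -
  let ?X = "\<lambda>n i::nat. if i = n then 1 else 0 :: 'f"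
  have "supp (?X n) = {n}" for n by (auto simp: supp_def)
  moreover have "?X n \<noteq> 0" for n by (auto simp: fun_eq_iff)
  ultimately show ?thesis by (intro exI[of _ ?X]) (simp add: BlockSeqs_def Evec_def)
qed

section \<open>Fusion of perfect sets and block sequences\<close>

definition perf :: "real set \<Rightarrow> bool" where
  "perf Q \<longleftrightarrow> compact Q \<and> Q \<noteq> {} \<and> (\<forall>x\<in>Q. x islimpt Q)"

lemma perf_closure:
  assumes "bounded S" "S \<noteq> {}" "\<And>x. x \<in> S \<Longrightarrow> x islimpt S"
  shows "perf (closure S)"
proof -
  have "x islimpt closure S" if "x \<in> closure S" for x
    using that assms(3) islimpt_subset[OF _ closure_subset] by (auto simp: closure_def)
  then show ?thesis using assms(1,2) by (simp add: perf_def)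
qed

text \<open>Intersecting with a closed ball could create isolated points on the boundary. The
  closure of the intersection with an open ball has none, and it stays inside \<open>I\<close> if
  the closed ball does.\<close>

lemma perf_Int_open:
  assumes "perf Q" "open I" "t \<in> Q" "t \<in> I"
  obtains Q' where "perf Q'" "Q' \<subseteq> Q" "Q' \<subseteq> I" "t \<in> Q'"
proof -
  obtain e where e: "e > 0" "cball t e \<subseteq> I"
    using assms open_contains_cball by blast
  let ?S = "Q \<inter> ball t e"
  have "x islimpt ?S" if "x \<in> ?S" for x
    using that assms(1) by (auto simp: perf_def intro!: islimpt_Int_eventually eventually_at_in_open')
  then have "perf (closure ?S)"
    using assms e by (intro perf_closure) auto
  moreover have "closure ?S \<subseteq> Q"
    using assms(1) by (intro closure_minimal) (auto simp: perf_def compact_imp_closed)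
  moreover have "closure ?S \<subseteq> I"
    using e closure_minimal[of ?S "cball t e"] by force
  moreover have "t \<in> closure ?S" using assms e closure_subset[of ?S] by auto
  ultimately show thesis using that by blast
qed

lemma perf_Icc: "perf {0..1}"
  by (auto simp: perf_def)

lemma perf_split:
  assumes R: "perf R" and e: "e > 0"
  obtains R' :: "bool \<Rightarrow> real set"
  where "\<And>b. perf (R' b)" "\<And>b. R' b \<subseteq> R" "R' True \<inter> R' False = {}"
    "\<And>b x y. x \<in> R' b \<Longrightarrow> y \<in> R' b \<Longrightarrow> dist x y < e"
proof -
  obtain s where s: "s \<in> R" "s islimpt R" using R by (auto simp: perf_def)
  then obtain t where t: "t \<in> R" "t \<noteq> s"
    using islimptE[OF s(2), of UNIV] by auto
  \<comment> \<open>Halving \<open>e\<close> bounds the diameters of the two balls, halving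
    \<open>dist s t\<close> makes them disjoint.\<close>
  define d where "d = min e (dist s t) / 2"
  have d: "d > 0" "2 * d \<le> e" "2 * d \<le> dist s t"
    using e t by (auto simp: d_def)
  obtain S where S: "perf S" "S \<subseteq> R" "S \<subseteq> ball s d"
    by (rule perf_Int_open[OF R open_ball s(1), of s d]) (use d in auto)
  obtain T where T: "perf T" "T \<subseteq> R" "T \<subseteq> ball t d"
    by (rule perf_Int_open[OF R open_ball t(1), of t d]) (use d in auto)
  have "ball s d \<inter> ball t d = {}"
    using d(3) by (intro disjoint_ballI) simp
  then have "S \<inter> T = {}" using S T by blast
  moreover have small: "dist x y < e" if "x \<in> ball c d" "y \<in> ball c d" for x y c :: real
    using that d dist_triangle_half_r[of c x "2 * d" y] by simp
  have "dist x y < e" if "x \<in> (if b then S else T)" "y \<in> (if b then S else T)" for b x y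
  proof (cases b)
    case True
    then show ?thesis using that subsetD[OF S(3)] small[of x s y] by simp
  next
    case False
    then show ?thesis using that subsetD[OF T(3)] small[of x t y] by simp
  qed
  ultimately show thesis
    using S(1,2) T(1,2) by (intro that[of "\<lambda>b. if b then S else T"]) simp_all
qed

text \<open>The nodes of one level are treated one after another with a common block sequence; what
  was achieved at earlier nodes survives its shrinking by monotonicity.\<close>

lemma refine_finite:
  fixes X :: "nat \<Rightarrow> nat \<Rightarrow> 'f::field"
  assumes mono: "\<And>Q X Q' Y. D Q X \<Longrightarrow> Q' \<subseteq> Q \<Longrightarrow> Y \<in> BlockSeqs \<Longrightarrow> alm Y X \<Longrightarrow> D Q' Y"
    and dense: "\<And>Q' Y. perf Q' \<Longrightarrow> Q' \<subseteq> Q \<Longrightarrow> Y \<in> BlockSeqs \<Longrightarrow> alm Y X \<Longrightarrow>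
          \<exists>Q''\<subseteq>Q'. \<exists>Y'\<in>BlockSeqs. perf Q'' \<and> alm Y' Y \<and> D Q'' Y'"
    and "finite S" and X: "X \<in> BlockSeqs" and H: "\<And>s. s \<in> S \<Longrightarrow> perf (H s) \<and> H s \<subseteq> Q"
  shows "\<exists>H'. \<exists>Y\<in>BlockSeqs. alm Y X \<and> (\<forall>s\<in>S. perf (H' s) \<and> H' s \<subseteq> H s \<and> D (H' s) Y)"
  using \<open>finite S\<close> H
proof (induction S)
  case empty
  then show ?case using X alm_refl by blast
next
  case (insert s S)
  then obtain H' Y where H': "Y \<in> BlockSeqs" "alm Y X" "\<forall>s\<in>S. perf (H' s) \<and> H' s \<subseteq> H s \<and> D (H' s) Y"
    by (metis insertCI)
  obtain R Y' where R: "R \<subseteq> H s" "Y' \<in> BlockSeqs" "perf R" "alm Y' Y" "D R Y'"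
    using dense[of "H s" Y] H' insert.prems by blast
  have "\<forall>r\<in>insert s S. perf ((H'(s := R)) r) \<and> (H'(s := R)) r \<subseteq> H r \<and> D ((H'(s := R)) r) Y'"
    using R H' mono insert.hyps by auto
  then show ?case using R(2,4) H'(2) alm_trans by blast
qed

text \<open>The set \<open>Q'\<close> is the set of branches through a binary tree of perfect sets, whose \<open>k\<close>-th
  level lies in the \<open>k\<close>-th dense family. Nodes are lists read from the right.\<close>

lemma fusion_nat:
  fixes X :: "nat \<Rightarrow> nat \<Rightarrow> 'f::field" and D :: "nat \<Rightarrow> real set \<Rightarrow> (nat \<Rightarrow> nat \<Rightarrow> 'f) \<Rightarrow> bool"
  assumes mono: "\<And>i Q X Q' Y. D i Q X \<Longrightarrow> Q' \<subseteq> Q \<Longrightarrow> Y \<in> BlockSeqs \<Longrightarrow> alm Y X \<Longrightarrow> D i Q' Y"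
    and dense: "\<And>i Q' Y. perf Q' \<Longrightarrow> Q' \<subseteq> Q \<Longrightarrow> Y \<in> BlockSeqs \<Longrightarrow> alm Y X \<Longrightarrow>
          \<exists>Q''\<subseteq>Q'. \<exists>Y'\<in>BlockSeqs. perf Q'' \<and> alm Y' Y \<and> D i Q'' Y'"
    and Q: "perf Q" and X: "X \<in> BlockSeqs"
  shows "\<exists>Q' Y. perf Q' \<and> Q' \<subseteq> Q \<and> Y \<in> BlockSeqs \<and> alm Y X \<and>
    (\<forall>i. \<forall>t\<in>Q'. \<exists>I. open I \<and> t \<in> I \<and> D i (Q' \<inter> I) Y)"
proof -
  \<comment> \<open>At stage \<open>k\<close> only the values on lists of length \<open>k\<close>
    matter, and all nodes of a level share one block sequence.\<close>
  define good where "good k p \<longleftrightarrow> snd p \<in> BlockSeqs \<and> alm (snd p) X \<and>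
     (\<forall>s. length s = k \<longrightarrow> perf (fst p s) \<and> fst p s \<subseteq> Q)"
    for k and p :: "(bool list \<Rightarrow> real set) \<times> (nat \<Rightarrow> nat \<Rightarrow> 'f)"
  define refine where "refine k p q \<longleftrightarrow> alm (snd q) (snd p) \<and> (\<forall>s. length s = k \<longrightarrow>
      (\<forall>b. fst q (b # s) \<subseteq> fst p s \<and> D k (fst q (b # s)) (snd q) \<and>
         (\<forall>x\<in>fst q (b # s). \<forall>y\<in>fst q (b # s). dist x y < 1 / real (Suc k))) \<and>
      fst q (True # s) \<inter> fst q (False # s) = {})"
    for k and p q :: "(bool list \<Rightarrow> real set) \<times> (nat \<Rightarrow> nat \<Rightarrow> 'f)"
  have step: "\<exists>q. good (Suc k) q \<and> refine k p q" if p: "good k p" for k p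
  proof -
    obtain G Y where GY: "p = (G, Y)" by (cases p)
    have "\<exists>R. (\<forall>b::bool. perf (R b) \<and> R b \<subseteq> G s) \<and> R True \<inter> R False = {} \<and>
        (\<forall>b. \<forall>x\<in>R b. \<forall>y\<in>R b. dist x y < 1 / real (Suc k))" if "length s = k" for s
      using perf_split[of "G s" "1 / real (Suc k)"] p that unfolding GY good_def
      by (metis fst_conv of_nat_0_less_iff zero_less_Suc zero_less_divide_1_iff)
    then obtain R where R: "\<And>s b. length s = k \<Longrightarrow> perf (R s b) \<and> R s b \<subseteq> G s"
      "\<And>s. length s = k \<Longrightarrow> R s True \<inter> R s False = {}"
      "\<And>s b x y. length s = k \<Longrightarrow> x \<in> R s b \<Longrightarrow> y \<in> R s b \<Longrightarrow> dist x y < 1 / real (Suc k)"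
      by metis
    define H where "H = (\<lambda>s. R (tl s) (hd s))"
    let ?S = "{s::bool list. length s = Suc k}"
    have fin: "finite ?S" using finite_lists_length_eq[of "UNIV::bool set" "Suc k"] by simp
    have H: "perf (H s) \<and> H s \<subseteq> Q" if "s \<in> ?S" for s
    proof -
      have len: "length (tl s) = k" using that by simp
      then have "G (tl s) \<subseteq> Q" using p by (simp add: GY good_def)
      then show ?thesis using R(1)[OF len] by (auto simp: H_def)
    qed
    have Y: "Y \<in> BlockSeqs" "alm Y X" using p by (auto simp: GY good_def)
    have dense': "\<exists>Q''\<subseteq>Q'. \<exists>Y'\<in>BlockSeqs. perf Q'' \<and> alm Y' Z \<and> D k Q'' Y'"
      if "perf Q'" "Q' \<subseteq> Q" "Z \<in> BlockSeqs" "alm Z Y" for Q' Z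
      using dense[OF that(1-3)] alm_trans[OF that(4) Y(2)] by blast
    have "\<exists>H'. \<exists>Y'\<in>BlockSeqs. alm Y' Y \<and> (\<forall>s\<in>?S. perf (H' s) \<and> H' s \<subseteq> H s \<and> D k (H' s) Y')"
      by (rule refine_finite[of "D k", OF mono dense' fin Y(1) H]) assumption+
    then obtain H' Y' where Y': "Y' \<in> BlockSeqs" "alm Y' Y"
      and H': "\<And>s. s \<in> ?S \<Longrightarrow> perf (H' s) \<and> H' s \<subseteq> H s \<and> D k (H' s) Y'"
      by blast
    have H'R: "H' (b # s) \<subseteq> R s b" if "length s = k" for b s
      using H'[of "b # s"] that by (simp add: H_def)
    have H'Q: "perf (H' s) \<and> H' s \<subseteq> Q" if "s \<in> ?S" for s
      using H'[OF that] H[OF that] by blast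
    have "good (Suc k) (H', Y')"
      using H'Q Y' alm_trans[OF Y'(2) Y(2)] by (simp add: good_def)
    moreover have "refine k p (H', Y')"
    proof -
      have "H' (b # s) \<subseteq> G s \<and> D k (H' (b # s)) Y' \<and>
          (\<forall>x\<in>H' (b # s). \<forall>y\<in>H' (b # s). dist x y < 1 / real (Suc k))" if "length s = k" for b s
      proof -
        have "D k (H' (b # s)) Y'" using H'[of "b # s"] that by simp
        then show ?thesis
          using H'R[OF that, of b] R(1)[OF that, of b] R(3)[OF that, of _ b] by blast
      qed
      moreover have "H' (True # s) \<inter> H' (False # s) = {}" if "length s = k" for s
        using H'R[OF that] R(2)[OF that] by blast
      ultimately show ?thesis using Y' by (simp add: refine_def GY)
    qed
    ultimately show ?thesis by blast
  qed
  have "good 0 (\<lambda>_. Q, X)" using Q X by (simp add: good_def)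
  then obtain p where "\<forall>k. good k (p k) \<and> refine k (p k) (p (Suc k))"
    using dependent_nat_choice[of good refine] step by blast
  then have good: "\<And>k. good k (p k)" and refine: "\<And>k. refine k (p k) (p (Suc k))" by auto
  define G where "G = (\<lambda>s. fst (p (length s)) s)"
  have G: "perf (G s)" "G s \<subseteq> Q" for s
    using good by (auto simp: good_def G_def)
  have G_Cons: "G (b # s) \<subseteq> G s" for b s
    using refine[of "length s"] by (simp add: refine_def G_def)
  have G_disj: "G (True # s) \<inter> G (False # s) = {}" for s
    using refine[of "length s"] by (simp add: refine_def G_def)
  have G_small: "dist x y < 1 / real (Suc (length s))" if "x \<in> G (b # s)" "y \<in> G (b # s)" for x y b s
    using refine[of "length s"] that by (simp add: refine_def G_def)
  have G_D: "D (length s) (G (b # s)) (snd (p (Suc (length s))))" for b s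
    using refine[of "length s"] by (simp add: refine_def G_def)
  obtain Y where Y: "Y \<in> BlockSeqs" "\<And>k. alm Y (snd (p k))"
    using pseudo_intersection[of "\<lambda>k. snd (p k)"] good refine unfolding good_def refine_def by blast
  define L where "L = (\<lambda>k. \<Union>s\<in>{s. length s = k}. G s)"
  define P where "P = (\<Inter>k. L k)"
  have finS: "finite {s::bool list. length s = k}" for k
    using finite_lists_length_eq[of "UNIV::bool set" k] by simp
  have comp: "compact (G s)" for s using G by (simp add: perf_def)
  have L_Suc: "L (Suc k) \<subseteq> L k" for k
  proof
    fix x assume "x \<in> L (Suc k)"
    then obtain s where s: "length s = Suc k" "x \<in> G s" by (auto simp: L_def)
    then show "x \<in> L k" using G_Cons[of "hd s" "tl s"] by (cases s) (auto simp: L_def)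
  qed
  have L_mono: "L k \<subseteq> L j" if "j \<le> k" for j k
    using that by (rule lift_Suc_antimono_le[of L, OF L_Suc])
  have "compact (L k)" for k
    unfolding L_def by (intro compact_UN finS comp)
  then have compP: "compact P"
    unfolding P_def by (intro compact_Inter) auto
  have inP: "\<exists>x. x \<in> G s \<and> x \<in> P" for s
  proof -
    \<comment> \<open>The branch below \<open>s\<close> that always takes \<open>False\<close>: its
      sets are compact and nested, and a common point lies in every level.\<close>
    define H where "H = (\<lambda>j. G (replicate j False @ s))"
    have "H (Suc j) \<subseteq> H j" for j unfolding H_def using G_Cons by simp
    then have mono: "H k \<subseteq> H j" if "j \<le> k" for j k
      using that by (rule lift_Suc_antimono_le[of H])
    have "(\<Inter>j. H j) \<noteq> {}"
      by (rule compact_nest) (use G comp mono in \<open>auto simp: H_def perf_def\<close>)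
    then obtain x where x: "\<And>j. x \<in> H j" by auto
    have "x \<in> L j" for j
    proof -
      have "x \<in> L (j + length s)"
        using x[of j] by (auto simp: L_def H_def intro!: exI[of _ "replicate j False @ s"])
      then show ?thesis using L_mono[of j "j + length s"] by auto
    qed
    then have "x \<in> P" by (simp add: P_def)
    then show ?thesis using x[of 0] by (auto simp: H_def)
  qed
  have "x islimpt P" if x: "x \<in> P" for x
    unfolding islimpt_approachable
  proof (intro allI impI)
    fix e :: real assume "e > 0"
    then obtain k where k: "1 / real (Suc k) < e" using nat_approx_posE by metis
    have "x \<in> L (Suc k)" using x by (auto simp: P_def)
    then obtain s where s: "length s = Suc k" "x \<in> G s" by (auto simp: L_def)
    then obtain b r where br: "s = b # r" "length r = k" by (cases s) auto
    \<comment> \<open>At most one child of \<open>s\<close> contains \<open>x\<close>; the other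
      supplies a point of \<open>P\<close> close to \<open>x\<close> and different from it.\<close>
    obtain c where c: "x \<notin> G (c # s)" using G_disj[of s] by blast
    obtain y where y: "y \<in> G (c # s)" "y \<in> P" using inP by blast
    have "y \<in> G s" using y(1) G_Cons by blast
    then have "dist y x < e" using G_small[of y b r x] br s k by simp
    moreover have "y \<noteq> x" using y(1) c by auto
    ultimately show "\<exists>x'\<in>P. x' \<noteq> x \<and> dist x' x < e" using y(2) by blast
  qed
  then have "perf P"
    using compP inP[of "[]"] by (auto simp: perf_def)
  moreover have "P \<subseteq> Q"
    using G(2)[of "[]"] by (auto simp: P_def L_def)
  moreover have "\<exists>I. open I \<and> t \<in> I \<and> D i (P \<inter> I) Y" if t: "t \<in> P" for i t
  proof -
    have disj: "G s \<inter> G s' = {}" if "length s = length s'" "s \<noteq> s'" for s s'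
      using that
    proof (induction s s' rule: list_induct2)
      case (Cons b s c s')
      show ?case
      proof (cases "s = s'")
        case True
        then show ?thesis using Cons.prems G_disj[of s] by (cases b; cases c) auto
      next
        case False
        then have "G s \<inter> G s' = {}" by (rule Cons.IH)
        then show ?thesis using G_Cons[of b s] G_Cons[of c s'] by auto
      qed
    qed simp
    have "t \<in> L (Suc i)" using t by (auto simp: P_def)
    then obtain s where s: "length s = Suc i" "t \<in> G s" by (auto simp: L_def)
    \<comment> \<open>Removing the finitely many other nodes of this level leaves an open set whose
      trace on \<open>P\<close> lies inside the node of \<open>t\<close>.\<close>
    define C where "C = (\<Union>s'\<in>{s'. length s' = Suc i} - {s}. G s')"
    have "closed C"
      unfolding C_def by (intro closed_UN finite_Diff finS) (simp add: comp compact_imp_closed)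
    moreover have "t \<notin> G s'" if "length s' = Suc i" "s' \<noteq> s" for s'
      using disj[of s s'] s that by auto
    then have "t \<notin> C" by (auto simp: C_def)
    moreover have "P \<inter> - C \<subseteq> G s"
    proof
      fix x assume x: "x \<in> P \<inter> - C"
      then obtain s' where "length s' = Suc i" "x \<in> G s'"
        unfolding P_def L_def by auto
      then show "x \<in> G s" using x by (auto simp: C_def)
    qed
    moreover have "D i (G s) (snd (p (Suc i)))"
      using s G_D[of "tl s" "hd s"] by (cases s) auto
    ultimately show ?thesis
      using mono[of i "G s" _ "P \<inter> - C" Y, OF _ _ Y(1) Y(2)]
      by (intro exI[of _ "- C"]) (simp add: open_Compl)
  qed
  moreover have "alm Y X" using Y(2)[of 0] good[of 0] alm_trans by (auto simp: good_def)
  ultimately show ?thesis using Y(1) by blast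
qed

lemma fusion:
  fixes X :: "nat \<Rightarrow> nat \<Rightarrow> 'f::field" and D :: "'i \<Rightarrow> real set \<Rightarrow> (nat \<Rightarrow> nat \<Rightarrow> 'f) \<Rightarrow> bool"
  assumes J: "countable J"
    and mono: "\<And>i Q X Q' Y. D i Q X \<Longrightarrow> Q' \<subseteq> Q \<Longrightarrow> Y \<in> BlockSeqs \<Longrightarrow> alm Y X \<Longrightarrow> D i Q' Y"
    and dense: "\<And>i Q' Y. i \<in> J \<Longrightarrow> perf Q' \<Longrightarrow> Q' \<subseteq> Q \<Longrightarrow> Y \<in> BlockSeqs \<Longrightarrow> alm Y X \<Longrightarrow>
          \<exists>Q''\<subseteq>Q'. \<exists>Y'\<in>BlockSeqs. perf Q'' \<and> alm Y' Y \<and> D i Q'' Y'"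
    and Q: "perf Q" and X: "X \<in> BlockSeqs"
  shows "\<exists>Q' Y. perf Q' \<and> Q' \<subseteq> Q \<and> Y \<in> BlockSeqs \<and> alm Y X \<and>
    (\<forall>i\<in>J. \<forall>t\<in>Q'. \<exists>I. open I \<and> t \<in> I \<and> D i (Q' \<inter> I) Y)"
proof (cases "J = {}")
  case True
  then show ?thesis using Q X alm_refl[of X] by blast
next
  case False
  then have J': "range (from_nat_into J) = J" using J by (rule range_from_nat_into)
  then have in_J: "from_nat_into J n \<in> J" for n by blast
  have "\<exists>Q' Y. perf Q' \<and> Q' \<subseteq> Q \<and> Y \<in> BlockSeqs \<and> alm Y X \<and>
      (\<forall>n. \<forall>t\<in>Q'. \<exists>I. open I \<and> t \<in> I \<and> D (from_nat_into J n) (Q' \<inter> I) Y)"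
    by (rule fusion_nat[of "\<lambda>n. D (from_nat_into J n)", OF mono dense[OF in_J] Q X])
  then obtain Q' Y where "perf Q'" "Q' \<subseteq> Q" "Y \<in> BlockSeqs" "alm Y X"
    and *: "\<forall>n. \<forall>t\<in>Q'. \<exists>I. open I \<and> t \<in> I \<and> D (from_nat_into J n) (Q' \<inter> I) Y"
    by blast
  moreover have "\<exists>I. open I \<and> t \<in> I \<and> D i (Q' \<inter> I) Y" if i: "i \<in> J" and t: "t \<in> Q'" for i t
  proof -
    obtain n where "i = from_nat_into J n" using J' i by blast
    then show ?thesis using * t by simp
  qed
  ultimately show ?thesis by blast
qed

text \<open>A fusion over the requirements of omitting \<open>c\<close>, for \<open>c\<close> in
  \<open>C\<close>: one of two disjoint perfect subsets omits a given point. Rational block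
  sequences merely fill the second coordinate of the conditions.\<close>

lemma perf_diff_countable:
  assumes Q: "perf Q" and C: "countable C"
  shows "\<exists>Q'. perf Q' \<and> Q' \<subseteq> Q - C"
proof -
  obtain X :: "nat \<Rightarrow> nat \<Rightarrow> rat" where X: "X \<in> BlockSeqs" using BlockSeqs_nonempty by blast
  have dense: "\<exists>Q''\<subseteq>Q'. \<exists>Y'\<in>BlockSeqs. perf Q'' \<and> alm Y' Y \<and> c \<notin> Q''"
    if Q': "perf Q'" and Y: "Y \<in> BlockSeqs" for c Q' and Y :: "nat \<Rightarrow> nat \<Rightarrow> rat"
  proof -
    obtain R where R: "\<And>b. perf (R b)" "\<And>b. R b \<subseteq> Q'" "R True \<inter> R False = {}"
      using perf_split[OF Q' zero_less_one] by metis
    then obtain b where "c \<notin> R b" by blast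
    then show ?thesis using R Y alm_refl by blast
  qed
  have "\<exists>Q' Y. perf Q' \<and> Q' \<subseteq> Q \<and> Y \<in> BlockSeqs \<and> alm Y X \<and>
      (\<forall>c\<in>C. \<forall>t\<in>Q'. \<exists>I. open I \<and> t \<in> I \<and> c \<notin> Q' \<inter> I)"
    by (rule fusion[OF C _ _ Q X]) (use dense in auto)
  then show ?thesis by blast
qed

text \<open>The instance of \<open>fusion\<close> whose requirements do not mention the parameters:
  any point of the resulting perfect set then yields all of them.\<close>

lemma diagonalize:
  fixes X :: "nat \<Rightarrow> nat \<Rightarrow> 'f::field" and E :: "'i \<Rightarrow> (nat \<Rightarrow> nat \<Rightarrow> 'f) \<Rightarrow> bool"
  assumes J: "countable J" and X: "X \<in> BlockSeqs"
    and mono: "\<And>i X Y. E i X \<Longrightarrow> Y \<in> BlockSeqs \<Longrightarrow> alm Y X \<Longrightarrow> E i Y"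
    and dense: "\<And>i Y. i \<in> J \<Longrightarrow> Y \<in> BlockSeqs \<Longrightarrow> alm Y X \<Longrightarrow> \<exists>Y'\<in>BlockSeqs. alm Y' Y \<and> E i Y'"
  shows "\<exists>Y\<in>BlockSeqs. alm Y X \<and> (\<forall>i\<in>J. E i Y)"
proof -
  have dense': "\<exists>Q''\<subseteq>Q'. \<exists>Y'\<in>BlockSeqs. perf Q'' \<and> alm Y' Y \<and> E i Y'"
    if "i \<in> J" "perf Q'" "Y \<in> BlockSeqs" "alm Y X" for i Q' Y
    using dense[OF that(1,3,4)] that(2) by blast
  have "\<exists>Q' Y. perf Q' \<and> Q' \<subseteq> {0..1} \<and> Y \<in> BlockSeqs \<and> alm Y X \<and>
      (\<forall>i\<in>J. \<forall>t\<in>Q'. \<exists>I. open I \<and> t \<in> I \<and> E i Y)"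
    by (rule fusion[OF J mono dense' perf_Icc X])
  then obtain Q' Y where "perf Q'" "Y \<in> BlockSeqs" "alm Y X"
    and *: "\<forall>i\<in>J. \<forall>t\<in>Q'. \<exists>I. open I \<and> t \<in> I \<and> E i Y"
    by blast
  moreover from \<open>perf Q'\<close> obtain t where "t \<in> Q'" by (auto simp: perf_def)
  ultimately show ?thesis by blast
qed

section \<open>A dichotomy for one move\<close>

lemma lspan_subset: "S \<subseteq> lspan T \<Longrightarrow> lspan S \<subseteq> lspan T"
  unfolding lspan_eq_span by (metis fun_space.span_mono fun_space.span_span)

lemma lspan_mono: "S \<subseteq> T \<Longrightarrow> lspan S \<subseteq> lspan T"
  unfolding lspan_eq_span by (rule fun_space.span_mono)

lemma lspan_superset: "S \<subseteq> lspan S"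
  unfolding lspan_eq_span by (rule fun_space.span_superset)

lemma bspan_finite_stage:
  assumes "v \<in> bspan Z"
  shows "\<exists>k\<ge>j. v \<in> lspan (Z ` {..<k})"
proof -
  let ?U = "{v. \<exists>k. v \<in> fun_space.span (Z ` {..<k})}"
  have mono: "fun_space.span (Z ` {..<k}) \<subseteq> fun_space.span (Z ` {..<l})" if "k \<le> l" for k l
    by (rule fun_space.span_mono) (use that in auto)
  have add: "x + y \<in> ?U" if x: "x \<in> ?U" and y: "y \<in> ?U" for x y
  proof -
    obtain k l where "x \<in> fun_space.span (Z ` {..<k})" "y \<in> fun_space.span (Z ` {..<l})"
      using x y by blast
    then have "x \<in> fun_space.span (Z ` {..<max k l})" "y \<in> fun_space.span (Z ` {..<max k l})"
      using mono[of k "max k l"] mono[of l "max k l"] by auto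
    then show ?thesis using fun_space.span_add by blast
  qed
  have "fun_space.subspace ?U"
    unfolding fun_space.subspace_def
    using add fun_space.span_zero fun_space.span_scale by blast
  moreover have "range Z \<subseteq> ?U"
    by (auto intro!: fun_space.span_base)
  ultimately have "bspan Z \<subseteq> ?U"
    unfolding bspan_def lspan_eq_span by (rule fun_space.span_minimal[rotated])
  then obtain k where "v \<in> fun_space.span (Z ` {..<k})" using assms by blast
  then have "v \<in> fun_space.span (Z ` {..<max j k})" using mono[of k "max j k"] by auto
  then show ?thesis unfolding lspan_eq_span by (intro exI[of _ "max j k"]) simp
qed

text \<open>\<open>zs\<close> holds the vectors already committed and \<open>Y\<close> is the
  reservoir for later ones. They are spanned jointly because sums of old and new vectors must be
  controlled too.\<close>

definition avoids :: "(real \<Rightarrow> (nat \<Rightarrow> 'f::field) set) \<Rightarrow> real \<Rightarrow> (nat \<Rightarrow> 'f) list \<Rightarrow> (nat \<Rightarrow> nat \<Rightarrow> 'f) \<Rightarrow> bool" where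
  "avoids D t zs Y \<longleftrightarrow> (\<forall>v\<in>lspan (set zs \<union> range Y). v \<noteq> 0 \<longrightarrow> v \<notin> D t)"

lemma avoids_mono:
  assumes "avoids D t zs Y" "set zs' \<subseteq> lspan (set zs \<union> range Y)" "range Y' \<subseteq> lspan (set zs \<union> range Y)"
  shows "avoids D t zs' Y'"
  using assms lspan_subset[of "set zs' \<union> range Y'" "set zs \<union> range Y"] unfolding avoids_def by auto

text \<open>The first component of \<open>prod_decode k\<close> takes every value \<open>j\<close>
  for arbitrarily large \<open>k\<close>, so each \<open>T j\<close> is approached by other terms at
  distances tending to 0.\<close>

lemma closure_condensing_sequence:
  fixes T :: "nat \<Rightarrow> real"
  assumes "perf Q" "\<And>k. T k \<in> Q"
    and near: "\<And>k. T (Suc k) \<noteq> T (fst (prod_decode k))"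
      "\<And>k. dist (T (Suc k)) (T (fst (prod_decode k))) < 1 / real (Suc k)"
  shows "perf (closure (range T))" "closure (range T) \<subseteq> Q"
proof -
  have "compact Q" using assms(1) by (simp add: perf_def)
  have "range T \<subseteq> Q" using assms(2) by blast
  show "perf (closure (range T))"
  proof (rule perf_closure)
    show "bounded (range T)"
      using \<open>compact Q\<close> \<open>range T \<subseteq> Q\<close> by (meson bounded_subset compact_imp_bounded)
    fix x assume "x \<in> range T"
    then obtain j where x: "x = T j" by blast
    show "x islimpt range T"
      unfolding islimpt_approachable
    proof (intro allI impI)
      fix e :: real assume "e > 0"
      then obtain n where n: "1 / real (Suc n) < e" using nat_approx_posE by metis
      define k where "k = prod_encode (j, n)"
      have "n \<le> k" unfolding k_def by (rule le_prod_encode_2)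
      then have "1 / real (Suc k) \<le> 1 / real (Suc n)" by (simp add: frac_le)
      moreover have "fst (prod_decode k) = j" by (simp add: k_def)
      ultimately show "\<exists>x'\<in>range T. x' \<noteq> x \<and> dist x' x < e"
        using near[of k] n x by (intro bexI[of _ "T (Suc k)"]) auto
    qed
  qed auto
  show "closure (range T) \<subseteq> Q"
    using \<open>compact Q\<close> \<open>range T \<subseteq> Q\<close> by (intro closure_minimal compact_imp_closed)
qed

text \<open>A parameter \<open>t\<close> outside countably many exceptions that admits a subspace avoiding
  \<open>D t\<close>, even after committing to finitely many vectors \<open>zs\<close>, is a limit of uncountably many
  such parameters below every \<open>Y\<close>. So one can alternate between adding new parameters close
  to old ones and adding new vectors; the closure of the parameters is the perfect set.\<close>

lemma avoid_or_dense:
  fixes X :: "nat \<Rightarrow> nat \<Rightarrow> 'f::{field,countable}" and D :: "real \<Rightarrow> (nat \<Rightarrow> 'f) set"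
  assumes Q: "perf Q" and X: "X \<in> BlockSeqs"
    and openD: "\<And>t v. t \<in> Q \<Longrightarrow> v \<in> D t \<Longrightarrow> \<exists>I. open I \<and> t \<in> I \<and> (\<forall>t'\<in>Q \<inter> I. v \<in> D t')"
  shows "(\<exists>Q' Z. perf Q' \<and> Q' \<subseteq> Q \<and> Z \<in> BlockSeqs \<and> alm Z X \<and>
            (\<forall>t\<in>Q'. \<forall>v\<in>bspan Z. v \<noteq> 0 \<longrightarrow> v \<notin> D t)) \<or>
         (\<exists>X'\<in>BlockSeqs. alm X' X \<and>
            countable {t\<in>Q. \<not> (\<forall>W\<in>BlockSeqs. alm W X' \<longrightarrow> (\<exists>v\<in>bspan W. v \<noteq> 0 \<and> v \<in> D t))})"
    (is "?A \<or> ?B")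
proof -
  define R where "R = (\<lambda>zs Y. {t\<in>Q. \<exists>Z\<in>BlockSeqs. alm Z Y \<and> avoids D t zs Z})"
  have R_mono: "R zs Y \<subseteq> R zs Y'" if "alm Y Y'" for zs Y Y'
    unfolding R_def using that alm_trans by blast
  have R_Nil: "{t\<in>Q. \<not> (\<forall>W\<in>BlockSeqs. alm W Y \<longrightarrow> (\<exists>v\<in>bspan W. v \<noteq> 0 \<and> v \<in> D t))} = R [] Y" for Y
    unfolding R_def avoids_def bspan_def by auto
  obtain B :: "real set set" where B: "countable B" "topological_basis B"
    using ex_countable_basis by blast
  \<comment> \<open>Once this holds for all \<open>zs\<close> and all basic \<open>I\<close>,
    further shrinking of the block sequence cannot turn an uncountable set of parameters into a
    countable one.\<close>
  define E where "E = (\<lambda>(zs, I) Y. countable (R zs Y \<inter> I) \<or>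
      (\<forall>Y'\<in>BlockSeqs. alm Y' Y \<longrightarrow> uncountable (R zs Y' \<inter> I)))"
  define J where "J = lists (Evec :: (nat \<Rightarrow> 'f) set) \<times> B"
  have "countable J"
    unfolding J_def using countable_Evec B(1) by (intro countable_SIGMA countable_lists)
  moreover have "E i Y'" if "E i Y" "Y' \<in> BlockSeqs" "alm Y' Y" for i Y Y'
  proof -
    obtain zs I where i: "i = (zs, I)" by (cases i)
    show ?thesis
    proof (cases "countable (R zs Y \<inter> I)")
      case True
      then have "countable (R zs Y' \<inter> I)"
        by (rule countable_subset[rotated]) (use R_mono[OF that(3)] in blast)
      then show ?thesis by (simp add: E_def i)
    next
      case False
      then show ?thesis using that alm_trans[OF _ that(3)] by (simp add: E_def i)
    qed
  qed
  moreover have "\<exists>Y'\<in>BlockSeqs. alm Y' Y \<and> E i Y'" if Y: "Y \<in> BlockSeqs" for i Y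
  proof -
    obtain zs I where i: "i = (zs, I)" by (cases i)
    show ?thesis
    proof (cases "\<exists>Y'\<in>BlockSeqs. alm Y' Y \<and> countable (R zs Y' \<inter> I)")
      case False
      then show ?thesis using Y by (intro bexI[of _ Y]) (auto simp: E_def i)
    qed (auto simp: E_def i)
  qed
  ultimately have "\<exists>Y\<in>BlockSeqs. alm Y X \<and> (\<forall>i\<in>J. E i Y)"
    using X by (intro diagonalize[of J X E])
  then obtain X1 where X1: "X1 \<in> BlockSeqs" "alm X1 X"
    and stable: "\<And>zs I. zs \<in> lists Evec \<Longrightarrow> I \<in> B \<Longrightarrow> E (zs, I) X1"
    by (auto simp: J_def)
  \<comment> \<open>For finitely supported \<open>zs\<close>, a parameter of \<open>R zs X1\<close>
    outside \<open>N\<close> is a condensation point of \<open>R zs Y\<close> for every block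
    sequence \<open>Y\<close> almost below \<open>X1\<close>.\<close>
  define N where "N = (\<Union>(zs, I)\<in>{i\<in>J. countable (R (fst i) X1 \<inter> snd i)}. R zs X1 \<inter> I)"
  have N: "countable N"
    unfolding N_def by (intro countable_UN countable_subset[OF _ \<open>countable J\<close>]) auto
  have many: "\<exists>t'\<in>R zs Y - N. t' \<noteq> t \<and> dist t' t < e"
    if t: "t \<in> R zs X1 - N" and zs: "zs \<in> lists Evec" and "e > 0" and Y: "Y \<in> BlockSeqs" "alm Y X1"
    for t zs e Y
  proof -
    obtain I where I: "I \<in> B" "t \<in> I" "I \<subseteq> ball t e"
      using topological_basisE[OF B(2) open_ball, of t t e] \<open>e > 0\<close> by auto
    have "uncountable (R zs X1 \<inter> I)"
      using t I zs by (auto simp: N_def J_def)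
    then have "uncountable (R zs Y \<inter> I)"
      using stable[OF zs I(1)] Y by (auto simp: E_def)
    then have "uncountable (R zs Y \<inter> I - insert t N)"
      using N by (intro uncountable_minus_countable) simp_all
    then obtain t' where "t' \<in> R zs Y \<inter> I - insert t N"
      by (metis all_not_in_conv countable_empty)
    then show ?thesis using I(3) by (intro bexI[of _ t']) (auto simp: dist_commute)
  qed
  have ?A if "\<not> ?B"
  proof -
    have big: "uncountable (R [] Y)" if "Y \<in> BlockSeqs" "alm Y X" for Y
      using \<open>\<not> ?B\<close> that unfolding R_Nil by blast
    \<comment> \<open>Step \<open>k\<close> adds a parameter near the one with index
      \<open>\<pi> k\<close>, which is already present because
      \<open>\<pi> k \<le> k\<close>.\<close>
    define \<pi> where "\<pi> k = fst (prod_decode k)" for k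
    have \<pi>: "\<pi> k \<le> k" for k
      using le_prod_encode_1[of "fst (prod_decode k)" "snd (prod_decode k)"] by (simp add: \<pi>_def)
    define good where "good = (\<lambda>k (ts, zs, Y). length ts = Suc k \<and> length zs = k \<and>
      zs \<in> lists Evec \<and> Y \<in> BlockSeqs \<and> alm Y X1 \<and> (\<forall>t\<in>set ts. t \<in> Q - N \<and> avoids D t zs Y))"
    define succ where "succ = (\<lambda>k (ts :: real list, zs :: (nat \<Rightarrow> 'f) list, Y) (ts', zs', Y'). \<exists>t z. ts' = ts @ [t] \<and> zs' = zs @ [z] \<and>
      t \<noteq> ts ! \<pi> k \<and> dist t (ts ! \<pi> k) < 1 / real (Suc k) \<and> z \<in> bspan Y \<and> z \<in> Evec \<and> z \<noteq> 0 \<and>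
      (\<forall>y\<in>bspan Y'. above (Max (supp z)) y) \<and> below Y' Y)"
    have step: "\<exists>q. good (Suc k) q \<and> succ k p q" if p: "good k p" for k p
    proof -
      obtain ts zs Y where tzY: "p = (ts, zs, Y)" by (cases p)
      have g: "length ts = Suc k" "length zs = k" "zs \<in> lists Evec" "Y \<in> BlockSeqs" "alm Y X1"
        "\<And>t. t \<in> set ts \<Longrightarrow> t \<in> Q - N \<and> avoids D t zs Y"
        using p by (auto simp: good_def tzY)
      define s where "s = ts ! \<pi> k"
      have "s \<in> set ts" using g(1) \<pi>[of k] by (simp add: s_def)
      then have "s \<in> R zs X1 - N" using g unfolding R_def by blast
      then obtain t where t: "t \<in> R zs Y - N" "t \<noteq> s" "dist t s < 1 / real (Suc k)"
        using many[of s zs "1 / real (Suc k)" Y] g by auto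
      then obtain Z0 where Z0: "Z0 \<in> BlockSeqs" "alm Z0 Y" "avoids D t zs Z0" "t \<in> Q"
        by (auto simp: R_def)
      \<comment> \<open>Passing to a tail puts the new reservoir below \<open>Y\<close> exactly and
        not only modulo finite. So the earlier parameters stay avoided, and so does
        \<open>t\<close>, since the tail is part of \<open>Z0\<close>.\<close>
      obtain m where m: "below (shift m Z0) Y" using alm_imp_below_shift[OF Z0(2,1)] .
      define Z where "Z = shift m Z0"
      have Z: "Z \<in> BlockSeqs" "below Z Y" using Z0 m by (auto simp: Z_def)
      define z where "z = Z 0"
      define Y' where "Y' = shift 1 Z"
      have sub: "avoids D r (zs @ [z]) Y'" if "avoids D r zs Z" for r
      proof (rule avoids_mono[OF that])
        have "set (zs @ [z]) \<subseteq> set zs \<union> range Z" by (auto simp: z_def)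
        then show "set (zs @ [z]) \<subseteq> lspan (set zs \<union> range Z)" using lspan_superset by blast
        have "range Y' \<subseteq> set zs \<union> range Z" by (auto simp: Y'_def shift_def)
        then show "range Y' \<subseteq> lspan (set zs \<union> range Z)" using lspan_superset by blast
      qed
      have "avoids D r (zs @ [z]) Y'" if "r \<in> set ts" for r
      proof (rule sub, rule avoids_mono)
        show "avoids D r zs Y" using g(6) that by blast
        show "set zs \<subseteq> lspan (set zs \<union> range Y)" using lspan_superset by blast
        have "range Z \<subseteq> bspan Y" using Z(2) in_bspan unfolding below_def by blast
        also have "bspan Y \<subseteq> lspan (set zs \<union> range Y)"
          unfolding bspan_def by (rule lspan_mono) blast
        finally show "range Z \<subseteq> lspan (set zs \<union> range Y)" .
      qed
      moreover have "avoids D t (zs @ [z]) Y'"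
      proof (rule sub, rule avoids_mono[OF Z0(3)])
        show "set zs \<subseteq> lspan (set zs \<union> range Z0)" using lspan_superset by blast
        have "range Z \<subseteq> set zs \<union> range Z0" by (auto simp: Z_def shift_def)
        then show "range Z \<subseteq> lspan (set zs \<union> range Z0)" using lspan_superset by blast
      qed
      moreover have z: "z \<in> Evec" "z \<noteq> 0" using BlockSeqsD[OF Z(1)] by (auto simp: z_def)
      moreover have Y': "Y' \<in> BlockSeqs" "below Y' Y"
        using Z below_shift[of 1 Z] unfolding Y'_def below_def by auto
      moreover have "alm Y' X1" using below_imp_alm[OF Y'(2)] g(5) alm_trans by blast
      ultimately have "good (Suc k) (ts @ [t], zs @ [z], Y')"
        using g t Z0(4) by (auto simp: good_def)
      moreover have "z \<in> bspan Y" using Z(2) in_bspan unfolding below_def z_def by blast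
      moreover have "\<forall>y\<in>bspan Y'. above (Max (supp z)) y"
        using bspan_shift_above_Max[OF Z(1), of _ 0] by (simp add: z_def Y'_def)
      ultimately have "good (Suc k) (ts @ [t], zs @ [z], Y') \<and> succ k p (ts @ [t], zs @ [z], Y')"
        using t z Y' by (simp add: succ_def tzY s_def)
      then show ?thesis by blast
    qed
    have "\<exists>p0. good 0 p0"
    proof -
      have "uncountable (R [] X1 - N)"
        using big[OF X1] N by (rule uncountable_minus_countable)
      then obtain t where "t \<in> R [] X1 - N" by (metis all_not_in_conv countable_empty)
      then obtain Z where "Z \<in> BlockSeqs" "alm Z X1" "avoids D t [] Z" "t \<in> Q - N"
        by (auto simp: R_def)
      then have "good 0 ([t], [], Z)" by (simp add: good_def)
      then show ?thesis by blast
    qed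
    then obtain p where p: "\<And>k. good k (p k)" "\<And>k. succ k (p k) (p (Suc k))"
      using dependent_nat_choice[of good succ] step by blast
    define Y where "Y k = snd (snd (p k))" for k
    define T where "T k = fst (p k) ! k" for k
    define Z where "Z k = fst (snd (p (Suc k))) ! k" for k
    have p_eq: "p k = (map T [0..<Suc k], map Z [0..<k], Y k)" for k
    proof (induction k)
      case 0
      obtain ts zs Y0 where p0: "p 0 = (ts, zs, Y0)" by (cases "p 0")
      have "length ts = 1" "zs = []" using p(1)[of 0] by (auto simp: good_def p0)
      then have "ts = [T 0]" by (cases ts) (auto simp: T_def p0)
      then show ?case using \<open>zs = []\<close> by (simp add: p0 Y_def)
    next
      case (Suc k)
      obtain t z where "fst (p (Suc k)) = map T [0..<Suc k] @ [t]"
        "fst (snd (p (Suc k))) = map Z [0..<k] @ [z]"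
        using p(2)[of k] Suc by (cases "p (Suc k)") (auto simp: succ_def)
      moreover from this have "t = T (Suc k)" "z = Z k"
        by (simp_all add: T_def Z_def nth_append)
      ultimately show ?case by (simp add: Y_def prod_eq_iff)
    qed
    have YB: "Y k \<in> BlockSeqs" "alm (Y k) X1" for k
      using p(1)[of k] by (auto simp: good_def p_eq)
    have av: "avoids D (T j) (map Z [0..<k]) (Y k)" "T j \<in> Q" if "j \<le> k" for j k
      using p(1)[of k] that by (auto simp: good_def p_eq)
    have nx: "T (Suc k) \<noteq> T (\<pi> k)" "dist (T (Suc k)) (T (\<pi> k)) < 1 / real (Suc k)"
      "Z k \<in> bspan (Y k)" "Z k \<in> Evec" "Z k \<noteq> 0" "below (Y (Suc k)) (Y k)"
      "\<And>y. y \<in> bspan (Y (Suc k)) \<Longrightarrow> above (Max (supp (Z k))) y" for k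
    proof -
      have "map T [0..<Suc k] ! \<pi> k = T (\<pi> k)"
        using \<pi>[of k] by (subst nth_map) (auto simp del: upt_Suc)
      then show "T (Suc k) \<noteq> T (\<pi> k)" "dist (T (Suc k)) (T (\<pi> k)) < 1 / real (Suc k)"
        "Z k \<in> bspan (Y k)" "Z k \<in> Evec" "Z k \<noteq> 0" "below (Y (Suc k)) (Y k)"
        "\<And>y. y \<in> bspan (Y (Suc k)) \<Longrightarrow> above (Max (supp (Z k))) y"
        using p(2)[of k] unfolding p_eq succ_def by auto
    qed
    have ZB: "Z \<in> BlockSeqs"
      unfolding BlockSeqs_iff using nx by blast
    have "bspan (Y k) \<subseteq> bspan (Y 0)" for k
      by (induction k) (use nx(6) in \<open>auto simp: below_def\<close>)
    then have "below Z (Y 0)"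
      unfolding below_def using nx(3) by (intro bspan_subset) blast
    then have "alm Z X"
      using below_imp_alm YB(2)[of 0] X1(2) alm_trans by blast
    \<comment> \<open>A vector of \<open>bspan Z\<close> uses finitely many terms of
      \<open>Z\<close>; a stage \<open>k \<ge> j\<close> at which they are committed avoids
      \<open>D (T j)\<close>.\<close>
    have Tv: "v \<notin> D (T j)" if v: "v \<in> bspan Z" "v \<noteq> 0" for v j
    proof -
      obtain k where k: "k \<ge> j" "v \<in> lspan (Z ` {..<k})"
        using bspan_finite_stage[OF v(1)] by blast
      have "lspan (Z ` {..<k}) \<subseteq> lspan (set (map Z [0..<k]) \<union> range (Y k))"
        by (rule lspan_mono) (auto simp: atLeast0LessThan)
      then show ?thesis using av(1)[OF k(1)] k(2) v(2) unfolding avoids_def by blast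
    qed
    have P: "perf (closure (range T))" "closure (range T) \<subseteq> Q"
      using closure_condensing_sequence[of Q T] Q av(2) nx(1,2) by (auto simp: \<pi>_def)
    \<comment> \<open>Openness carries avoidance from the dense set of all \<open>T j\<close> to its
      closure.\<close>
    have "v \<notin> D t" if t: "t \<in> closure (range T)" and v: "v \<in> bspan Z" "v \<noteq> 0" for t v
    proof
      assume "v \<in> D t"
      then obtain I where I: "open I" "t \<in> I" "\<forall>t'\<in>Q \<inter> I. v \<in> D t'"
        using openD P(2) t by blast
      then obtain j where "T j \<in> I"
        using t open_Int_closure_eq_empty[of I "range T"] by blast
      then show False using I(3) av(2)[of j j] Tv[OF v] by auto
    qed
    then show ?A using P ZB \<open>alm Z X\<close> by blast
  qed
  then show ?thesis by blast
qed

section \<open>A dichotomy for open games\<close>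

text \<open>The hypotheses make \<open>P\<close> an ideal of sets, so a finite subcover
  suffices.\<close>

lemma compact_local_imp_global:
  assumes "compact Q" "P {}"
    and Un: "\<And>S T. P S \<Longrightarrow> P T \<Longrightarrow> P (S \<union> T)"
    and sub: "\<And>S T. P S \<Longrightarrow> T \<subseteq> S \<Longrightarrow> P T"
    and loc: "\<And>t. t \<in> Q \<Longrightarrow> \<exists>I. open I \<and> t \<in> I \<and> P (Q \<inter> I)"
  shows "P Q"
proof -
  have "\<forall>t\<in>Q. \<exists>I. open I \<and> t \<in> I \<and> P (Q \<inter> I)" using loc by blast
  from bchoice[OF this] obtain I where I: "\<forall>t\<in>Q. open (I t) \<and> t \<in> I t \<and> P (Q \<inter> I t)"
    by (elim exE)
  have cover: "Q \<subseteq> (\<Union>t\<in>Q. I t)" using I by blast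
  have op: "open (I t)" if "t \<in> Q" for t using I that by blast
  obtain F where F: "F \<subseteq> Q" "finite F" "Q \<subseteq> (\<Union>t\<in>F. I t)"
    using compactE_image[OF assms(1) op cover] .
  have "P (\<Union>t\<in>F. Q \<inter> I t)"
    using F(2,1)
  proof induction
    case empty
    then show ?case using assms(2) by simp
  next
    case (insert t F)
    then have "P (Q \<inter> I t)" "P (\<Union>t\<in>F. Q \<inter> I t)" using I by blast+
    then show ?case using Un by simp
  qed
  then show ?thesis by (rule sub) (use F(3) in blast)
qed

text \<open>Positions are arbitrary lists here; a move beyond the support of the position is available
  because every tail of \<open>W\<close> is again a legal move of player I.\<close>

inductive reach :: "((nat \<Rightarrow> 'f::field) list \<Rightarrow> bool) \<Rightarrow> (nat \<Rightarrow> nat \<Rightarrow> 'f) \<Rightarrow> (nat \<Rightarrow> 'f) list \<Rightarrow> bool"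
  for T X where
  reach_now: "T xs \<Longrightarrow> reach T X xs"
| reach_step: "\<forall>W\<in>BlockSeqs. alm W X \<longrightarrow> (\<exists>y\<in>bspan W. y \<noteq> 0 \<and> reach T X (xs @ [y])) \<Longrightarrow> reach T X xs"

lemma reach_mono:
  assumes "reach T X xs" "alm Y X"
  shows "reach T Y xs"
  using assms(1)
proof induction
  case (reach_step xs)
  show ?case
  proof (rule reach.reach_step, intro ballI impI)
    fix W :: "nat \<Rightarrow> nat \<Rightarrow> 'a" assume "W \<in> BlockSeqs" "alm W Y"
    then show "\<exists>y\<in>bspan W. y \<noteq> 0 \<and> reach T Y (xs @ [y])"
      using reach_step.IH alm_trans[OF _ assms(2)] by blast
  qed
qed (rule reach.reach_now)

text \<open>Runs of the asymptotic game resumed at \<open>xs\<close>, without the rule that they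
  form a block sequence. This only enlarges the set of runs that I has to handle; at the empty
  position it contains \<open>asym_outcomes\<close>.\<close>

definition follows ::
  "(nat \<Rightarrow> nat \<Rightarrow> 'f::field) \<Rightarrow> ((nat \<Rightarrow> 'f) list \<Rightarrow> nat) \<Rightarrow> (nat \<Rightarrow> 'f) list \<Rightarrow> (nat \<Rightarrow> nat \<Rightarrow> 'f) \<Rightarrow> bool" where
  "follows X \<sigma> xs x \<longleftrightarrow> map x [0..<length xs] = xs \<and>
     (\<forall>k\<ge>length xs. x k \<in> bspan X \<and> x k \<noteq> 0 \<and> above (\<sigma> (map x [0..<k])) (x k))"

text \<open>Countably many exceptions are tolerated because the one-move dichotomy produces them;
  they accumulate countably and are removed at the end.\<close>

definition reach_ae ::
  "(real \<Rightarrow> (nat \<Rightarrow> 'f::field) list \<Rightarrow> bool) \<Rightarrow> (nat \<Rightarrow> 'f) list \<Rightarrow> real set \<Rightarrow> (nat \<Rightarrow> nat \<Rightarrow> 'f) \<Rightarrow> bool" where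
  "reach_ae T xs Q X \<longleftrightarrow> countable {t\<in>Q. \<not> reach (T t) X xs}"

lemma reach_ae_mono:
  assumes "reach_ae T xs Q X" "Q' \<subseteq> Q" "alm Y X"
  shows "reach_ae T xs Q' Y"
  unfolding reach_ae_def
  by (rule countable_subset[OF _ assms(1)[unfolded reach_ae_def]])
     (use assms(2) reach_mono[OF _ assms(3)] in auto)

text \<open>Second countability: every point of the set is among the countably many exceptions
  inside some basic open set, and there are countably many pairs of an index and such a set.\<close>

lemma countable_local_exceptions:
  fixes Q :: "real set"
  assumes J: "countable J"
  shows "countable {t\<in>Q. \<exists>i\<in>J. \<not> R i t \<and> (\<exists>I. open I \<and> t \<in> I \<and> countable {s\<in>Q \<inter> I. \<not> R i s})}"
    (is "countable ?N")
proof -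
  obtain B :: "real set set" where B: "countable B" "topological_basis B"
    using ex_countable_basis by blast
  let ?K = "{p\<in>J \<times> B. countable {s\<in>Q \<inter> snd p. \<not> R (fst p) s}}"
  have "countable ?K"
    by (rule countable_subset[of _ "J \<times> B"]) (use J B in auto)
  then have "countable (\<Union>p\<in>?K. {s\<in>Q \<inter> snd p. \<not> R (fst p) s})"
    by (intro countable_UN) auto
  moreover have "?N \<subseteq> (\<Union>p\<in>?K. {s\<in>Q \<inter> snd p. \<not> R (fst p) s})"
  proof
    fix t assume "t \<in> ?N"
    then obtain i I where i: "t \<in> Q" "i \<in> J" "\<not> R i t" "open I" "t \<in> I" "countable {s\<in>Q \<inter> I. \<not> R i s}"
      by blast
    obtain I' where I': "I' \<in> B" "t \<in> I'" "I' \<subseteq> I"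
      using topological_basisE[OF B(2) i(4,5)] .
    have "countable {s\<in>Q \<inter> I'. \<not> R i s}"
      by (rule countable_subset[OF _ i(6)]) (use I' in auto)
    then have "(i, I') \<in> ?K" using i(2) I'(1) by simp
    then show "t \<in> (\<Union>p\<in>?K. {s\<in>Q \<inter> snd p. \<not> R (fst p) s})"
      using i(1,3) I'(2) by (intro UN_I[of "(i, I')"]) simp_all
  qed
  ultimately show ?thesis by (rule countable_subset[rotated])
qed

text \<open>At every position the one-move dichotomy is applied to the relation that one more move
  leads to a locally good position (\<open>G\<close>). Either I can prevent this, or every move of I
  leaves II such a vector, and then the position itself is good up to countably many parameters. If
  \<open>xs0\<close> is good nowhere, I stays outside \<open>G\<close> forever, and there
  \<open>T\<close> cannot hold.\<close>

lemma open_game_dichotomy: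
  fixes X :: "nat \<Rightarrow> nat \<Rightarrow> 'f::{field,countable}" and T :: "real \<Rightarrow> (nat \<Rightarrow> 'f) list \<Rightarrow> bool"
  assumes Q: "perf Q" and X: "X \<in> BlockSeqs" and xs0: "xs0 \<in> lists Evec"
    and openT: "\<And>t xs. t \<in> Q \<Longrightarrow> T t xs \<Longrightarrow> \<exists>I. open I \<and> t \<in> I \<and> (\<forall>t'\<in>Q \<inter> I. T t' xs)"
  shows "\<exists>Q' X'. perf Q' \<and> Q' \<subseteq> Q \<and> X' \<in> BlockSeqs \<and> alm X' X \<and>
    (reach_ae T xs0 Q' X' \<or>
     (\<exists>\<sigma>. \<forall>x. follows X' \<sigma> xs0 x \<longrightarrow> (\<forall>k\<ge>length xs0. \<forall>t\<in>Q'. \<not> T t (map x [0..<k]))))"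
proof -
  have cJ: "countable (lists (Evec :: (nat \<Rightarrow> 'f) set))"
    using countable_Evec by (rule countable_lists)
  define never where "never xs Q X \<longleftrightarrow>
      (\<forall>Q'\<subseteq>Q. \<forall>Y\<in>BlockSeqs. perf Q' \<longrightarrow> alm Y X \<longrightarrow> \<not> reach_ae T xs Q' Y)" for xs Q X
  have never_mono: "never xs Q' Y" if "never xs Q X" "Q' \<subseteq> Q" "alm Y X" for xs Q X Q' Y
    using that alm_trans[OF _ that(3)] unfolding never_def by blast
  have "\<exists>Q1 X1. perf Q1 \<and> Q1 \<subseteq> Q \<and> X1 \<in> BlockSeqs \<and> alm X1 X \<and>
      (\<forall>xs\<in>lists Evec. \<forall>t\<in>Q1. \<exists>I. open I \<and> t \<in> I \<and>
         (reach_ae T xs (Q1 \<inter> I) X1 \<or> never xs (Q1 \<inter> I) X1))"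
  proof (rule fusion[OF cJ _ _ Q X])
    fix xs Q X Q' Y
    assume "reach_ae T xs Q X \<or> never xs Q X" "Q' \<subseteq> Q" "Y \<in> BlockSeqs" "alm Y X"
    then show "reach_ae T xs Q' Y \<or> never xs Q' Y"
      using reach_ae_mono never_mono by blast
  next
    fix xs Q' Y
    assume "perf Q'" "Q' \<subseteq> Q" "Y \<in> BlockSeqs" "alm Y X"
    then show "\<exists>Q''\<subseteq>Q'. \<exists>Y'\<in>BlockSeqs. perf Q'' \<and> alm Y' Y \<and> (reach_ae T xs Q'' Y' \<or> never xs Q'' Y')"
      unfolding never_def using alm_refl by blast
  qed
  then obtain Q1 X1 where Q1: "perf Q1" "Q1 \<subseteq> Q" and X1: "X1 \<in> BlockSeqs" "alm X1 X"
    and dec1: "\<And>xs t. xs \<in> lists Evec \<Longrightarrow> t \<in> Q1 \<Longrightarrow> \<exists>I. open I \<and> t \<in> I \<and>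
         (reach_ae T xs (Q1 \<inter> I) X1 \<or> never xs (Q1 \<inter> I) X1)"
    by blast
  \<comment> \<open>Goodness refers to the fixed pair \<open>Q1\<close>, \<open>X1\<close> and to a
    neighbourhood of \<open>t\<close>; this makes it open in \<open>t\<close>, as
    \<open>avoid_or_dense\<close> demands.\<close>
  define G where "G xs t \<longleftrightarrow> (\<exists>I. open I \<and> t \<in> I \<and> reach_ae T xs (Q1 \<inter> I) X1)" for xs t
  have openG: "\<exists>I. open I \<and> t \<in> I \<and> (\<forall>t'\<in>S \<inter> I. G xs t')" if "G xs t" for xs t S
    using that unfolding G_def by blast
  \<comment> \<open>Parameters that are themselves exceptions at some position that is good near
    them.\<close>
  define N where "N = {t\<in>Q1. \<exists>xs\<in>lists Evec. \<not> reach (T t) X1 xs \<and> G xs t}"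
  have N: "countable N"
    unfolding N_def G_def reach_ae_def by (rule countable_local_exceptions[OF cJ])
  define D where "D xs Q X \<longleftrightarrow> reach_ae T xs Q X \<or>
      (\<exists>n. \<forall>y\<in>bspan X. y \<noteq> 0 \<longrightarrow> above n y \<longrightarrow> (\<forall>t\<in>Q. \<not> G (xs @ [y]) t))" for xs Q X
  have "\<exists>Q2 X2. perf Q2 \<and> Q2 \<subseteq> Q1 \<and> X2 \<in> BlockSeqs \<and> alm X2 X1 \<and>
      (\<forall>xs\<in>lists Evec. \<forall>t\<in>Q2. \<exists>I. open I \<and> t \<in> I \<and> D xs (Q2 \<inter> I) X2)"
  proof (rule fusion[OF cJ _ _ Q1(1) X1(1)])
    fix xs Q X Q' Y
    assume *: "D xs Q X" "Q' \<subseteq> Q" "Y \<in> BlockSeqs" "alm Y X"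
    show "D xs Q' Y"
    proof (cases "reach_ae T xs Q X")
      case True
      then have "reach_ae T xs Q' Y" by (rule reach_ae_mono) fact+
      then show ?thesis unfolding D_def by blast
    next
      case False
      then obtain n where 2: "\<forall>y\<in>bspan X. y \<noteq> 0 \<longrightarrow> above n y \<longrightarrow> (\<forall>t\<in>Q. \<not> G (xs @ [y]) t)"
        using *(1) unfolding D_def by auto
      obtain m where m: "\<forall>y\<in>bspan Y. above m y \<longrightarrow> y \<in> bspan X"
        using *(4) by (auto simp: alm_def)
      have "\<forall>y\<in>bspan Y. y \<noteq> 0 \<longrightarrow> above (max n m) y \<longrightarrow> (\<forall>t\<in>Q'. \<not> G (xs @ [y]) t)"
        using 2 m *(2) by (auto simp: above_def)
      then show ?thesis unfolding D_def by blast
    qed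
  next
    fix xs :: "(nat \<Rightarrow> 'f) list" and Q' Y
    assume xs: "xs \<in> lists Evec" and Q': "perf Q'" "Q' \<subseteq> Q1" and Y: "Y \<in> BlockSeqs" "alm Y X1"
    let ?D = "\<lambda>t. {y. G (xs @ [y]) t}"
    have "\<exists>I. open I \<and> t \<in> I \<and> (\<forall>t'\<in>Q' \<inter> I. v \<in> ?D t')" if "t \<in> Q'" "v \<in> ?D t" for t v
      using openG that by simp
    then have "(\<exists>P Z. perf P \<and> P \<subseteq> Q' \<and> Z \<in> BlockSeqs \<and> alm Z Y \<and>
          (\<forall>t\<in>P. \<forall>v\<in>bspan Z. v \<noteq> 0 \<longrightarrow> v \<notin> ?D t)) \<or>
        (\<exists>Z\<in>BlockSeqs. alm Z Y \<and>
          countable {t\<in>Q'. \<not> (\<forall>W\<in>BlockSeqs. alm W Z \<longrightarrow> (\<exists>v\<in>bspan W. v \<noteq> 0 \<and> v \<in> ?D t))})"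
      by (rule avoid_or_dense[OF Q'(1) Y(1)])
    then show "\<exists>Q''\<subseteq>Q'. \<exists>Y'\<in>BlockSeqs. perf Q'' \<and> alm Y' Y \<and> D xs Q'' Y'"
    proof (elim disjE)
      assume "\<exists>P Z. perf P \<and> P \<subseteq> Q' \<and> Z \<in> BlockSeqs \<and> alm Z Y \<and>
        (\<forall>t\<in>P. \<forall>v\<in>bspan Z. v \<noteq> 0 \<longrightarrow> v \<notin> ?D t)"
      then obtain P Z where P: "perf P" "P \<subseteq> Q'" "Z \<in> BlockSeqs" "alm Z Y"
        "\<forall>t\<in>P. \<forall>v\<in>bspan Z. v \<noteq> 0 \<longrightarrow> v \<notin> ?D t"
        by (elim exE conjE)
      have "\<forall>y\<in>bspan Z. y \<noteq> 0 \<longrightarrow> above 0 y \<longrightarrow> (\<forall>t\<in>P. \<not> G (xs @ [y]) t)"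
        using P(5) by simp
      then have "D xs P Z" unfolding D_def by (intro disjI2 exI)
      then show ?thesis using P by blast
    next
      assume "\<exists>Z\<in>BlockSeqs. alm Z Y \<and>
        countable {t\<in>Q'. \<not> (\<forall>W\<in>BlockSeqs. alm W Z \<longrightarrow> (\<exists>v\<in>bspan W. v \<noteq> 0 \<and> v \<in> ?D t))}"
      then obtain Z where dense: "Z \<in> BlockSeqs" "alm Z Y"
        "countable {t\<in>Q'. \<not> (\<forall>W\<in>BlockSeqs. alm W Z \<longrightarrow> (\<exists>v\<in>bspan W. v \<noteq> 0 \<and> v \<in> ?D t))}"
        by (elim bexE conjE)
      let ?E = "{t\<in>Q'. \<not> (\<forall>W\<in>BlockSeqs. alm W Z \<longrightarrow> (\<exists>v\<in>bspan W. v \<noteq> 0 \<and> v \<in> ?D t))}"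
      have "reach (T t) Z xs" if t: "t \<in> Q'" "t \<notin> N" "t \<notin> ?E" for t
      proof (rule reach_step, intro ballI impI)
        fix W :: "nat \<Rightarrow> nat \<Rightarrow> 'f" assume W: "W \<in> BlockSeqs" "alm W Z"
        then obtain v where v: "v \<in> bspan W" "v \<noteq> 0" "G (xs @ [v]) t" using t by blast
        have "xs @ [v] \<in> lists Evec" using xs v(1) bspan_Evec[OF W(1)] by auto
        then have "reach (T t) X1 (xs @ [v])"
          using v(3) t(1,2) Q'(2) unfolding N_def by blast
        then have "reach (T t) Z (xs @ [v])"
          by (rule reach_mono) (rule alm_trans[OF dense(2) Y(2)])
        then show "\<exists>y\<in>bspan W. y \<noteq> 0 \<and> reach (T t) Z (xs @ [y])" using v by blast
      qed
      then have "{t\<in>Q'. \<not> reach (T t) Z xs} \<subseteq> N \<union> ?E" by blast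
      then have "reach_ae T xs Q' Z"
        unfolding reach_ae_def using N dense(3) by (meson countable_Un countable_subset)
      then show ?thesis using dense(1,2) Q'(1) unfolding D_def by blast
    qed
  qed
  then obtain Q2 X2 where Q2: "perf Q2" "Q2 \<subseteq> Q1" and X2: "X2 \<in> BlockSeqs" "alm X2 X1"
    and dec2: "\<And>xs t. xs \<in> lists Evec \<Longrightarrow> t \<in> Q2 \<Longrightarrow> \<exists>I. open I \<and> t \<in> I \<and> D xs (Q2 \<inter> I) X2"
    by blast
  have alm2: "alm X2 X" using X2(2) X1(2) by (rule alm_trans)
  show ?thesis
  proof (cases "\<exists>P\<subseteq>Q2. perf P \<and> reach_ae T xs0 P X2")
    case True
    then show ?thesis using Q2(2) Q1(2) X2(1) alm2 by blast
  next
    case False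
    have start: "\<not> G xs0 t" if t: "t \<in> Q2" for t
    proof
      assume "G xs0 t"
      then obtain I where I: "open I" "t \<in> I" "reach_ae T xs0 (Q1 \<inter> I) X1" by (auto simp: G_def)
      obtain P where P: "perf P" "P \<subseteq> Q2" "P \<subseteq> I"
        using perf_Int_open[OF Q2(1) I(1) t I(2)] .
      then have "reach_ae T xs0 P X2"
        using reach_ae_mono[OF I(3) _ X2(2)] Q2(2) by blast
      then show False using False P by blast
    qed
    \<comment> \<open>Thresholds found near single parameters are joined by maxima over a finite
      cover of \<open>Q2\<close>, so one number serves all parameters.\<close>
    have step: "\<exists>n. \<forall>y\<in>bspan X2. y \<noteq> 0 \<longrightarrow> above n y \<longrightarrow> (\<forall>t\<in>Q2. \<not> G (xs @ [y]) t)"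
      if xs: "xs \<in> lists Evec" and nG: "\<forall>t\<in>Q2. \<not> G xs t" for xs
    proof -
      let ?P = "\<lambda>S. \<exists>n. \<forall>y\<in>bspan X2. y \<noteq> 0 \<longrightarrow> above n y \<longrightarrow> (\<forall>t\<in>S. \<not> G (xs @ [y]) t)"
      show "?P Q2"
      proof (rule compact_local_imp_global[of Q2 ?P])
        show "compact Q2" using Q2(1) by (simp add: perf_def)
        show "?P (S \<union> S')" if S: "?P S" and S': "?P S'" for S S'
        proof -
          obtain n m where "\<forall>y\<in>bspan X2. y \<noteq> 0 \<longrightarrow> above n y \<longrightarrow> (\<forall>t\<in>S. \<not> G (xs @ [y]) t)"
            "\<forall>y\<in>bspan X2. y \<noteq> 0 \<longrightarrow> above m y \<longrightarrow> (\<forall>t\<in>S'. \<not> G (xs @ [y]) t)"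
            using S S' by (elim exE)
          then have "\<forall>y\<in>bspan X2. y \<noteq> 0 \<longrightarrow> above (max n m) y \<longrightarrow> (\<forall>t\<in>S \<union> S'. \<not> G (xs @ [y]) t)"
            by (auto simp: above_def)
          then show ?thesis by (rule exI)
        qed
        show "?P S'" if "?P S" "S' \<subseteq> S" for S S'
          using that(1) by (rule ex_forward) (use that(2) in auto)
        show "\<exists>I. open I \<and> t \<in> I \<and> ?P (Q2 \<inter> I)" if t: "t \<in> Q2" for t
        proof -
          obtain I where I: "open I" "t \<in> I" "D xs (Q2 \<inter> I) X2" using dec2[OF xs t] by blast
          have "t \<in> Q1" using t Q2(2) by blast
          then obtain I' where I': "open I'" "t \<in> I'"
            "reach_ae T xs (Q1 \<inter> I') X1 \<or> never xs (Q1 \<inter> I') X1"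
            using dec1[OF xs] by blast
          have never: "never xs (Q1 \<inter> I') X1"
            using I' nG t unfolding G_def by blast
          have tI: "t \<in> I \<inter> I'" and oI: "open (I \<inter> I')" using I I' by auto
          obtain P where P: "perf P" "P \<subseteq> Q2" "P \<subseteq> I \<inter> I'"
            using perf_Int_open[OF Q2(1) oI t tI] .
          \<comment> \<open>\<open>P\<close> is a smaller condition near \<open>t\<close>, so
            \<open>never\<close> excludes the first alternative of \<open>D\<close>; the second one
            provides the threshold.\<close>
          have "\<not> reach_ae T xs P X2"
            using never P Q2(2) X2 unfolding never_def by blast
          then have "\<not> reach_ae T xs (Q2 \<inter> I) X2"
            using reach_ae_mono[of T xs "Q2 \<inter> I" X2 P X2] P by auto
          then show ?thesis using I unfolding D_def by blast
        qed
      qed simp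
    qed
    then have "\<exists>n. xs \<in> lists Evec \<longrightarrow> (\<forall>t\<in>Q2. \<not> G xs t) \<longrightarrow>
        (\<forall>y\<in>bspan X2. y \<noteq> 0 \<longrightarrow> above n y \<longrightarrow> (\<forall>t\<in>Q2. \<not> G (xs @ [y]) t))" for xs
      by blast
    then have "\<forall>xs. \<exists>n. xs \<in> lists Evec \<longrightarrow> (\<forall>t\<in>Q2. \<not> G xs t) \<longrightarrow>
        (\<forall>y\<in>bspan X2. y \<noteq> 0 \<longrightarrow> above n y \<longrightarrow> (\<forall>t\<in>Q2. \<not> G (xs @ [y]) t))" by (rule allI)
    from choice[OF this] obtain \<sigma> where \<sigma>: "\<forall>xs. xs \<in> lists Evec \<longrightarrow> (\<forall>t\<in>Q2. \<not> G xs t) \<longrightarrow>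
        (\<forall>y\<in>bspan X2. y \<noteq> 0 \<longrightarrow> above (\<sigma> xs) y \<longrightarrow> (\<forall>t\<in>Q2. \<not> G (xs @ [y]) t))"
      by (elim exE)
    have "\<not> T t (map x [0..<k])" if x: "follows X2 \<sigma> xs0 x" and k: "k \<ge> length xs0" and t: "t \<in> Q2"
      for x k t
    proof -
      have "map x [0..<k] \<in> lists Evec \<and> (\<forall>t\<in>Q2. \<not> G (map x [0..<k]) t)"
        using k
      proof (induction k rule: dec_induct)
        case base
        then show ?case using x xs0 start by (simp add: follows_def)
      next
        case (step k)
        then have "x k \<in> bspan X2" "x k \<noteq> 0" "above (\<sigma> (map x [0..<k])) (x k)"
          using x by (auto simp: follows_def)
        then have "\<forall>t\<in>Q2. \<not> G (map x [0..<k] @ [x k]) t" "x k \<in> Evec"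
          using step.IH \<sigma>[rule_format, of "map x [0..<k]"] bspan_Evec[OF X2(1)] by blast+
        then show ?case using step.IH by simp
      qed
      then have nG: "\<not> G (map x [0..<k]) t" using t by blast
      show ?thesis
      proof
        assume hit: "T t (map x [0..<k])"
        have "t \<in> Q" using t Q2(2) Q1(2) by blast
        from openT[OF this hit] obtain I where I: "open I" "t \<in> I" "\<forall>t'\<in>Q \<inter> I. T t' (map x [0..<k])"
          by (elim exE conjE)
        \<comment> \<open>A hit persists on a neighbourhood of \<open>t\<close>, and there
          \<open>reach\<close> holds without exceptions.\<close>
        have "{s \<in> Q1 \<inter> I. \<not> reach (T s) X1 (map x [0..<k])} = {}"
          using I(3) Q1(2) reach.reach_now[of "T _"] by auto
        then have "reach_ae T (map x [0..<k]) (Q1 \<inter> I) X1"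
          unfolding reach_ae_def by (simp only: countable_empty)
        then show False using nG I(1,2) unfolding G_def by blast
      qed
    qed
    then have "\<forall>x. follows X2 \<sigma> xs0 x \<longrightarrow> (\<forall>k\<ge>length xs0. \<forall>t\<in>Q2. \<not> T t (map x [0..<k]))"
      by simp
    moreover have "Q2 \<subseteq> Q" using Q2(2) Q1(2) by (rule subset_trans)
    ultimately show ?thesis using Q2(1) X2(1) alm2
      by (intro exI[of _ Q2] exI[of _ X2] conjI disjI2 exI[of _ \<sigma>])
  qed
qed

section \<open>The unfolded game\<close>

lemma follows_cong:
  assumes "follows Y \<rho> xs x"
    and "\<And>k. x k \<in> bspan Y \<Longrightarrow> above (\<rho> (map x [0..<k])) (x k) \<Longrightarrow>
      x k \<in> bspan X \<and> above (\<sigma> (map x [0..<k])) (x k)"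
  shows "follows X \<sigma> xs x"
  unfolding follows_def
proof (intro conjI allI impI)
  show "map x [0..<length xs] = xs" using assms(1) unfolding follows_def by (elim conjE)
  fix k assume "length xs \<le> k"
  then have "x k \<in> bspan Y" "x k \<noteq> 0" "above (\<rho> (map x [0..<k])) (x k)"
    using assms(1) unfolding follows_def by auto
  then show "x k \<in> bspan X" "x k \<noteq> 0" "above (\<sigma> (map x [0..<k])) (x k)"
    using assms(2)[of k] by auto
qed

lemma follows_le:
  assumes "follows X \<sigma>' xs x" "\<And>zs. \<sigma> zs \<le> \<sigma>' zs"
  shows "follows X \<sigma> xs x"
  using assms(1)
proof (rule follows_cong)
  fix k assume "x k \<in> bspan X" "above (\<sigma>' (map x [0..<k])) (x k)"
  then show "x k \<in> bspan X \<and> above (\<sigma> (map x [0..<k])) (x k)"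
    using above_mono[OF _ assms(2)] by blast
qed

text \<open>Raising all moves of I to at least \<open>n\<close> forces II's vectors from
  \<open>bspan Y\<close> into \<open>bspan X\<close>, so a strategy of I survives shrinking modulo
  finite.\<close>

lemma follows_alm:
  assumes "follows Y (\<lambda>zs. max (\<sigma> zs) n) xs x" "\<forall>y\<in>bspan Y. above n y \<longrightarrow> y \<in> bspan X"
  shows "follows X \<sigma> xs x"
  using assms(1)
proof (rule follows_cong)
  fix k assume k: "x k \<in> bspan Y" "above (max (\<sigma> (map x [0..<k])) n) (x k)"
  then have "above (\<sigma> (map x [0..<k])) (x k)" "above n (x k)"
    by (auto simp: above_def)
  then show "x k \<in> bspan X \<and> above (\<sigma> (map x [0..<k])) (x k)"
    using k(1) assms(2) by simp
qed

definition I_wins ::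
  "((nat \<Rightarrow> nat) \<Rightarrow> real \<times> (nat \<Rightarrow> nat \<Rightarrow> 'f::field)) \<Rightarrow> (nat \<Rightarrow> 'f) list \<Rightarrow> nat list \<Rightarrow> real set \<Rightarrow>
    (nat \<Rightarrow> nat \<Rightarrow> 'f) \<Rightarrow> bool" where
  "I_wins f xs u Q X \<longleftrightarrow> (\<exists>\<sigma>. \<forall>x. follows X \<sigma> xs x \<longrightarrow>
     (\<forall>t\<in>Q. \<forall>b. map b [0..<length u] = u \<longrightarrow> f b \<noteq> (t, x)))"

lemma I_wins_mono:
  assumes "I_wins f xs u Q X" "Q' \<subseteq> Q" "alm Y X"
  shows "I_wins f xs u Q' Y"
proof -
  obtain \<sigma> where \<sigma>: "\<forall>x. follows X \<sigma> xs x \<longrightarrow> (\<forall>t\<in>Q. \<forall>b. map b [0..<length u] = u \<longrightarrow> f b \<noteq> (t, x))"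
    using assms(1) unfolding I_wins_def by (elim exE)
  obtain n where n: "\<forall>y\<in>bspan Y. above n y \<longrightarrow> y \<in> bspan X"
    using assms(3) unfolding alm_def by (elim exE)
  have "\<forall>x. follows Y (\<lambda>zs. max (\<sigma> zs) n) xs x \<longrightarrow>
      (\<forall>t\<in>Q'. \<forall>b. map b [0..<length u] = u \<longrightarrow> f b \<noteq> (t, x))"
    using \<sigma> follows_alm[OF _ n] assms(2) by (meson subsetD)
  then show ?thesis unfolding I_wins_def by (intro exI[of _ "\<lambda>zs. max (\<sigma> zs) n"])
qed

text \<open>The maximum of two strategies obeys both. With compactness, wins near every parameter
  become a win on the whole set.\<close>

lemma I_wins_Un:
  assumes "I_wins f xs u Q X" "I_wins f xs u Q' X"
  shows "I_wins f xs u (Q \<union> Q') X"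
proof -
  obtain \<sigma> where \<sigma>: "\<forall>x. follows X \<sigma> xs x \<longrightarrow> (\<forall>t\<in>Q. \<forall>b. map b [0..<length u] = u \<longrightarrow> f b \<noteq> (t, x))"
    using assms(1) unfolding I_wins_def by (elim exE)
  obtain \<sigma>' where \<sigma>': "\<forall>x. follows X \<sigma>' xs x \<longrightarrow> (\<forall>t\<in>Q'. \<forall>b. map b [0..<length u] = u \<longrightarrow> f b \<noteq> (t, x))"
    using assms(2) unfolding I_wins_def by (elim exE)
  let ?\<rho> = "\<lambda>zs. max (\<sigma> zs) (\<sigma>' zs)"
  have "f b \<noteq> (t, x)" if x: "follows X ?\<rho> xs x" and t: "t \<in> Q \<union> Q'" and b: "map b [0..<length u] = u" for x t b
  proof -
    have "follows X \<sigma> xs x" "follows X \<sigma>' xs x" using x by (auto elim: follows_le)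
    then show ?thesis using \<sigma> \<sigma>' t b by blast
  qed
  then show ?thesis unfolding I_wins_def by (intro exI[of _ ?\<rho>]) simp
qed

text \<open>At a position of length \<open>k\<close>, player I also follows the strategies against all digits
  \<open>m \<le> k\<close> of the witness, started at each of the finitely many earlier positions.\<close>

lemma I_wins_merge:
  fixes X :: "nat \<Rightarrow> nat \<Rightarrow> 'f::field"
  assumes "\<And>x k m. follows X \<sigma> xs x \<Longrightarrow> length xs \<le> k \<Longrightarrow> length u < k \<Longrightarrow>
      I_wins f (map x [0..<k]) (u @ [m]) Q X"
  shows "I_wins f xs u Q X"
proof -
  have "\<exists>\<tau>. I_wins f zs (u @ [m]) Q X \<longrightarrow> (\<forall>x. follows X \<tau> zs x \<longrightarrow>
     (\<forall>t\<in>Q. \<forall>b. map b [0..<length (u @ [m])] = u @ [m] \<longrightarrow> f b \<noteq> (t, x)))" for zs m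
    unfolding I_wins_def by blast
  then have "\<forall>zs m. \<exists>\<tau>. I_wins f zs (u @ [m]) Q X \<longrightarrow> (\<forall>x. follows X \<tau> zs x \<longrightarrow>
     (\<forall>t\<in>Q. \<forall>b. map b [0..<length (u @ [m])] = u @ [m] \<longrightarrow> f b \<noteq> (t, x)))" by (intro allI)
  then obtain \<tau> where \<tau>: "\<forall>zs m. I_wins f zs (u @ [m]) Q X \<longrightarrow> (\<forall>x. follows X (\<tau> zs m) zs x \<longrightarrow>
     (\<forall>t\<in>Q. \<forall>b. map b [0..<length (u @ [m])] = u @ [m] \<longrightarrow> f b \<noteq> (t, x)))"
    unfolding choice_iff by (elim exE)
  \<comment> \<open>The demands at \<open>zs\<close> of the strategies started at an initial segment
    of \<open>zs\<close> against a digit at most \<open>length zs\<close>. They are finitely many,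
    so their maximum is a legal move.\<close>
  define M where "M zs = (\<lambda>(k, m). \<tau> (take k zs) m zs) ` ({..length zs} \<times> {..length zs})"
    for zs :: "(nat \<Rightarrow> 'f) list"
  define \<rho> where "\<rho> zs = max (\<sigma> zs) (Max (M zs))" for zs
  have M: "\<tau> (take k zs) m zs \<le> \<rho> zs" if "k \<le> length zs" "m \<le> length zs" for k m zs
  proof -
    have "\<tau> (take k zs) m zs \<in> M zs" unfolding M_def using that by (intro image_eqI[of _ _ "(k, m)"]) auto
    moreover have "finite (M zs)" unfolding M_def by simp
    ultimately show ?thesis unfolding \<rho>_def by (simp add: le_max_iff_disj)
  qed
  have "f b \<noteq> (t, x)" if x: "follows X \<rho> xs x" and t: "t \<in> Q" and b: "map b [0..<length u] = u" for x t b
  proof -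
    define m where "m = b (length u)"
    \<comment> \<open>The strategy against the actual next digit \<open>m\<close>, started at length
      \<open>k\<close>, is consulted at every later position because \<open>m \<le> k\<close>; the
      other two bounds make the hypothesis applicable.\<close>
    define k where "k = max m (max (length xs) (Suc (length u)))"
    have k: "m \<le> k" "length xs \<le> k" "length u < k" by (auto simp: k_def)
    have "follows X \<sigma> xs x" using x by (rule follows_le) (simp add: \<rho>_def)
    then have wins: "I_wins f (map x [0..<k]) (u @ [m]) Q X" using assms k by blast
    have "follows X (\<tau> (map x [0..<k]) m) (map x [0..<k]) x"
      unfolding follows_def
    proof (intro conjI allI impI)
      show "map x [0..<length (map x [0..<k])] = map x [0..<k]" by simp
      fix j assume "length (map x [0..<k]) \<le> j"
      then have j: "k \<le> j" by simp
      then show "x j \<in> bspan X" "x j \<noteq> 0" using x k unfolding follows_def by auto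
      have "above (\<rho> (map x [0..<j])) (x j)" using x k j unfolding follows_def by auto
      moreover have "\<tau> (take k (map x [0..<j])) m (map x [0..<j]) \<le> \<rho> (map x [0..<j])"
        using M[of k "map x [0..<j]" m] j k by simp
      moreover have "take k (map x [0..<j]) = map x [0..<k]"
        using j by (simp add: take_map take_upt)
      ultimately show "above (\<tau> (map x [0..<k]) m (map x [0..<j])) (x j)"
        using above_mono by metis
    qed
    moreover have "map b [0..<length (u @ [m])] = u @ [m]"
      using b by (simp add: m_def)
    ultimately show ?thesis using \<tau> wins t by blast
  qed
  then show ?thesis unfolding I_wins_def by (intro exI[of _ \<rho>]) simp
qed

text \<open>What a failure of I near \<open>t\<close> leaves behind: the parameter is only
  approximated, while the position and the digits are met exactly. Continuity of \<open>f\<close>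
  makes up for this in the limit.\<close>

definition live_at ::
  "((nat \<Rightarrow> nat) \<Rightarrow> real \<times> (nat \<Rightarrow> nat \<Rightarrow> 'f::field)) \<Rightarrow> real \<Rightarrow> (nat \<Rightarrow> 'f) list \<Rightarrow> nat list \<Rightarrow> bool" where
  "live_at f t xs u \<longleftrightarrow> (\<forall>I. open I \<longrightarrow> t \<in> I \<longrightarrow> (\<exists>b. map b [0..<length u] = u \<and>
     fst (f b) \<in> I \<and> map (snd (f b)) [0..<length xs] = xs))"

text \<open>The bound on the length keeps player II from announcing infinitely many digits at one position.\<close>

definition longer :: "('a list \<Rightarrow> nat list \<Rightarrow> bool) \<Rightarrow> nat list \<Rightarrow> 'a list \<Rightarrow> bool" where
  "longer L u xs \<longleftrightarrow> length u < length xs \<and> (\<exists>m. L xs (u @ [m]))"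

text \<open>Two fusions are needed because the target of the open game mentions \<open>L\<close>,
  which is defined only relative to the pair \<open>Q1\<close>, \<open>X1\<close> produced by
  deciding all pairs \<open>(xs, u)\<close>.\<close>

lemma unfolded_dichotomy:
  fixes f :: "(nat \<Rightarrow> nat) \<Rightarrow> real \<times> (nat \<Rightarrow> nat \<Rightarrow> 'f::{field,countable})"
  shows "\<exists>P X. perf P \<and> X \<in> BlockSeqs \<and> (I_wins f [] [] P X \<or>
    (\<forall>t\<in>P. \<exists>L. L [] [] \<and> (\<forall>xs\<in>lists Evec. \<forall>u. L xs u \<longrightarrow> reach (longer L u) X xs) \<and>
       (\<forall>xs u. L xs u \<longrightarrow> live_at f t xs u)))"
proof -
  obtain X0 :: "nat \<Rightarrow> nat \<Rightarrow> 'f" where X0: "X0 \<in> BlockSeqs" using BlockSeqs_nonempty by blast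
  define J where "J = lists (Evec :: (nat \<Rightarrow> 'f) set) \<times> (UNIV :: nat list set)"
  have cJ: "countable J"
    unfolding J_def using countable_Evec by (intro countable_SIGMA countable_lists) auto
  define never where "never p Q X \<longleftrightarrow> (\<forall>Q'\<subseteq>Q. \<forall>Y\<in>BlockSeqs. perf Q' \<longrightarrow> alm Y X \<longrightarrow>
      \<not> I_wins f (fst p) (snd p) Q' Y)" for p Q X
  have never_mono: "never p Q' Y" if "never p Q X" "Q' \<subseteq> Q" "alm Y X" for p Q X Q' Y
    using that alm_trans[OF _ that(3)] unfolding never_def by blast
  have "\<exists>Q1 X1. perf Q1 \<and> Q1 \<subseteq> {0..1} \<and> X1 \<in> BlockSeqs \<and> alm X1 X0 \<and>
      (\<forall>p\<in>J. \<forall>t\<in>Q1. \<exists>I. open I \<and> t \<in> I \<and>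
         (I_wins f (fst p) (snd p) (Q1 \<inter> I) X1 \<or> never p (Q1 \<inter> I) X1))"
  proof (rule fusion[OF cJ _ _ perf_Icc X0])
    fix p Q X Q' Y
    assume *: "I_wins f (fst p) (snd p) Q X \<or> never p Q X" "Q' \<subseteq> Q" "Y \<in> BlockSeqs" "alm Y X"
    from *(1) show "I_wins f (fst p) (snd p) Q' Y \<or> never p Q' Y"
      using I_wins_mono[OF _ *(2,4)] never_mono[OF _ *(2,4)] by blast
  next
    fix p Q' and Y :: "nat \<Rightarrow> nat \<Rightarrow> 'f"
    assume "perf Q'" "Y \<in> BlockSeqs"
    then show "\<exists>Q''\<subseteq>Q'. \<exists>Y'\<in>BlockSeqs. perf Q'' \<and> alm Y' Y \<and>
        (I_wins f (fst p) (snd p) Q'' Y' \<or> never p Q'' Y')"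
      unfolding never_def using alm_refl[of Y] by blast
  qed
  then obtain Q1 X1 where Q1: "perf Q1" and X1: "X1 \<in> BlockSeqs"
    and dec1: "\<forall>p\<in>J. \<forall>t\<in>Q1. \<exists>I. open I \<and> t \<in> I \<and>
         (I_wins f (fst p) (snd p) (Q1 \<inter> I) X1 \<or> never p (Q1 \<inter> I) X1)"
    by (elim exE conjE)
  \<comment> \<open>Stated through a neighbourhood of \<open>t\<close>, hence open in
    \<open>t\<close>; this gives the open target for the second fusion.\<close>
  define L where "L t xs u \<longleftrightarrow> (\<exists>I. open I \<and> t \<in> I \<and> never (xs, u) (Q1 \<inter> I) X1)" for t xs u
  have L_open: "\<exists>I. open I \<and> t \<in> I \<and> (\<forall>t'\<in>S \<inter> I. L t' xs u)" if "L t xs u" for t xs u S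
    using that unfolding L_def by blast
  have not_L: "\<exists>I. open I \<and> t \<in> I \<and> I_wins f xs u (Q1 \<inter> I) X1"
    if xs: "xs \<in> lists Evec" and t: "t \<in> Q1" and nL: "\<not> L t xs u" for xs u t
  proof -
    have "(xs, u) \<in> J" using xs by (simp add: J_def)
    then obtain I where "open I" "t \<in> I" "I_wins f xs u (Q1 \<inter> I) X1 \<or> never (xs, u) (Q1 \<inter> I) X1"
      using dec1 t by fastforce
    then show ?thesis using nL unfolding L_def by blast
  qed
  have L_never: "\<not> I_wins f xs u (Q \<inter> I) X"
    if L: "L t xs u" and Q: "perf Q" "Q \<subseteq> Q1" and X: "X \<in> BlockSeqs" "alm X X1"
      and I: "open I" and t: "t \<in> Q" "t \<in> I" for t xs u Q X I
  proof
    assume wins: "I_wins f xs u (Q \<inter> I) X"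
    obtain I' where I': "open I'" "t \<in> I'" "never (xs, u) (Q1 \<inter> I') X1"
      using L unfolding L_def by (elim exE conjE)
    have oI: "open (I \<inter> I')" and tI: "t \<in> I \<inter> I'" using I I' t by auto
    obtain P where P: "perf P" "P \<subseteq> Q" "P \<subseteq> I \<inter> I'"
      using perf_Int_open[OF Q(1) oI t(1) tI] .
    have "I_wins f xs u P X"
      by (rule I_wins_mono[OF wins]) (use P in auto)
    moreover have "P \<subseteq> Q1 \<inter> I'" using P Q by blast
    ultimately show False using I'(3) P(1) X unfolding never_def by auto
  qed
  have L_live: "live_at f t xs u" if L: "L t xs u" and t: "t \<in> Q1" for t xs u
    unfolding live_at_def
  proof (intro allI impI)
    fix I :: "real set" assume "open I" "t \<in> I"
    then have "\<not> I_wins f xs u (Q1 \<inter> I) X1"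
      using L_never[OF L Q1 order_refl X1 alm_refl] t by blast
    \<comment> \<open>A run defeating the constant strategy 0 already supplies the required point of
      the range of \<open>f\<close>.\<close>
    then obtain x s b where *: "follows X1 (\<lambda>_. 0) xs x" "s \<in> Q1 \<inter> I" "map b [0..<length u] = u" "f b = (s, x)"
      unfolding I_wins_def by blast
    then show "\<exists>b. map b [0..<length u] = u \<and> fst (f b) \<in> I \<and> map (snd (f b)) [0..<length xs] = xs"
      by (intro exI[of _ b]) (auto simp: follows_def)
  qed
  define E where "E p Q X \<longleftrightarrow> I_wins f (fst p) (snd p) Q X \<or>
      reach_ae (\<lambda>t. longer (L t) (snd p)) (fst p) Q X" for p Q X
  have "\<exists>Q2 X2. perf Q2 \<and> Q2 \<subseteq> Q1 \<and> X2 \<in> BlockSeqs \<and> alm X2 X1 \<and>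
      (\<forall>p\<in>J. \<forall>t\<in>Q2. \<exists>I. open I \<and> t \<in> I \<and> E p (Q2 \<inter> I) X2)"
  proof (rule fusion[OF cJ _ _ Q1 X1])
    fix p Q X Q' Y
    assume *: "E p Q X" "Q' \<subseteq> Q" "Y \<in> BlockSeqs" "alm Y X"
    from *(1) show "E p Q' Y"
      unfolding E_def using I_wins_mono[OF _ *(2,4)] reach_ae_mono[OF _ *(2,4)] by blast
  next
    fix p Q Y
    assume p: "p \<in> J" and Q: "perf Q" "Q \<subseteq> Q1" and Y: "Y \<in> BlockSeqs" "alm Y X1"
    obtain xs u where xu: "p = (xs, u)" by (cases p)
    have xs: "xs \<in> lists Evec" using p by (simp add: J_def xu)
    let ?T = "\<lambda>t. longer (L t) u"
    have "\<exists>I. open I \<and> t \<in> I \<and> (\<forall>t'\<in>Q \<inter> I. ?T t' ys)" if T: "?T t ys" for t ys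
    proof -
      obtain m where m: "length u < length ys" "L t ys (u @ [m])"
        using T unfolding longer_def by (elim exE conjE)
      from L_open[OF m(2), of Q] obtain I where I: "open I" "t \<in> I" "\<forall>t'\<in>Q \<inter> I. L t' ys (u @ [m])"
        by (elim exE conjE)
      have "\<forall>t'\<in>Q \<inter> I. ?T t' ys"
        unfolding longer_def using m(1) I(3) by blast
      then show ?thesis using I(1,2) by (intro exI[of _ I] conjI)
    qed
    then have "\<exists>Q' Z. perf Q' \<and> Q' \<subseteq> Q \<and> Z \<in> BlockSeqs \<and> alm Z Y \<and>
      (reach_ae ?T xs Q' Z \<or>
        (\<exists>\<sigma>. \<forall>x. follows Z \<sigma> xs x \<longrightarrow> (\<forall>k\<ge>length xs. \<forall>t\<in>Q'. \<not> ?T t (map x [0..<k]))))"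
      by (rule open_game_dichotomy[OF Q(1) Y(1) xs])
    then obtain Q' Z where Q': "perf Q'" "Q' \<subseteq> Q" and Z: "Z \<in> BlockSeqs" "alm Z Y"
      and alt: "reach_ae ?T xs Q' Z \<or>
        (\<exists>\<sigma>. \<forall>x. follows Z \<sigma> xs x \<longrightarrow> (\<forall>k\<ge>length xs. \<forall>t\<in>Q'. \<not> ?T t (map x [0..<k])))"
      by (elim exE conjE)
    from alt have "E p Q' Z"
    proof
      assume "\<exists>\<sigma>. \<forall>x. follows Z \<sigma> xs x \<longrightarrow> (\<forall>k\<ge>length xs. \<forall>t\<in>Q'. \<not> ?T t (map x [0..<k]))"
      then obtain \<sigma> where \<sigma>: "\<forall>x. follows Z \<sigma> xs x \<longrightarrow> (\<forall>k\<ge>length xs. \<forall>t\<in>Q'. \<not> ?T t (map x [0..<k]))"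
        by (elim exE)
      have "I_wins f xs u Q' Z"
      proof (rule I_wins_merge)
        fix x k m assume x: "follows Z \<sigma> xs x" and k: "length xs \<le> k" "length u < k"
        let ?ys = "map x [0..<k]"
        have ys: "?ys \<in> lists Evec"
        proof -
          have "x i \<in> Evec" if "i < k" for i
          proof (cases "i < length xs")
            case True
            have "map x [0..<length xs] ! i = x i" using True by simp
            then have "x i = xs ! i" using x by (simp add: follows_def)
            then show ?thesis using xs True by auto
          next
            case False
            then show ?thesis using x bspan_Evec[OF Z(1)] by (auto simp: follows_def)
          qed
          then show ?thesis by auto
        qed
        have nL: "\<not> L t ?ys (u @ [m])" if "t \<in> Q'" for t
          using \<sigma> x k that unfolding longer_def by auto
        \<comment> \<open>Outside \<open>L\<close>, I wins near every single parameter; compactness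
          of \<open>Q'\<close> glues these wins, and merging over \<open>m\<close> needs them on all
          of \<open>Q'\<close>.\<close>
        show "I_wins f ?ys (u @ [m]) Q' Z"
        proof (rule compact_local_imp_global[of Q' "\<lambda>S. I_wins f ?ys (u @ [m]) S Z"])
          show "compact Q'" using Q'(1) by (simp add: perf_def)
          show "I_wins f ?ys (u @ [m]) {} Z" by (simp add: I_wins_def)
          show "I_wins f ?ys (u @ [m]) (S \<union> S') Z"
            if "I_wins f ?ys (u @ [m]) S Z" "I_wins f ?ys (u @ [m]) S' Z" for S S'
            using that by (rule I_wins_Un)
          show "I_wins f ?ys (u @ [m]) S' Z"
            if "I_wins f ?ys (u @ [m]) S Z" "S' \<subseteq> S" for S S'
            using that by (rule I_wins_mono) simp
          fix t assume t: "t \<in> Q'"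
          have "t \<in> Q1" using t Q'(2) Q(2) by blast
          from not_L[OF ys this nL[OF t]]
          obtain I where I: "open I" "t \<in> I" "I_wins f ?ys (u @ [m]) (Q1 \<inter> I) X1" by (elim exE conjE)
          have "I_wins f ?ys (u @ [m]) (Q' \<inter> I) Z"
            by (rule I_wins_mono[OF I(3)]) (use Q' Q alm_trans[OF Z(2) Y(2)] in auto)
          then show "\<exists>I. open I \<and> t \<in> I \<and> I_wins f ?ys (u @ [m]) (Q' \<inter> I) Z"
            using I(1,2) by (intro exI[of _ I] conjI)
        qed
      qed
      then show "E p Q' Z" by (simp add: E_def xu)
    qed (simp add: E_def xu)
    then show "\<exists>Q'\<subseteq>Q. \<exists>Y'\<in>BlockSeqs. perf Q' \<and> alm Y' Y \<and> E p Q' Y'"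
      using Q' Z by blast
  qed
  then obtain Q2 X2 where Q2: "perf Q2" "Q2 \<subseteq> Q1" and X2: "X2 \<in> BlockSeqs" "alm X2 X1"
    and dec2: "\<forall>p\<in>J. \<forall>t\<in>Q2. \<exists>I. open I \<and> t \<in> I \<and> E p (Q2 \<inter> I) X2"
    by (elim exE conjE)
  show ?thesis
  proof (cases "\<exists>P\<subseteq>Q2. perf P \<and> I_wins f [] [] P X2")
    case True
    then show ?thesis using X2(1) by blast
  next
    case False
    have start: "L t [] []" if t: "t \<in> Q2" for t
    proof (rule ccontr)
      assume nL: "\<not> L t [] []"
      have "t \<in> Q1" using t Q2 by blast
      from not_L[OF lists.Nil this nL]
      obtain I where I: "open I" "t \<in> I" "I_wins f [] [] (Q1 \<inter> I) X1" by (elim exE conjE)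
      obtain P where P: "perf P" "P \<subseteq> Q2" "P \<subseteq> I" using perf_Int_open[OF Q2(1) I(1) t I(2)] .
      have "I_wins f [] [] P X2" by (rule I_wins_mono[OF I(3) _ X2(2)]) (use P Q2 in blast)
      then show False using False P by blast
    qed
    define R where "R p t \<longleftrightarrow> reach (longer (L t) (snd p)) X2 (fst p)" for p t
    \<comment> \<open>The open game gives II a way to continue for all but countably many parameters
      near \<open>t\<close>; on the perfect set chosen outside \<open>N\<close> it holds at every
      parameter.\<close>
    define N where "N = {t\<in>Q2. \<exists>p\<in>J. \<not> R p t \<and> (\<exists>I. open I \<and> t \<in> I \<and> countable {s\<in>Q2 \<inter> I. \<not> R p s})}"
    have "countable N" unfolding N_def by (rule countable_local_exceptions[OF cJ])
    then obtain P where P: "perf P" "P \<subseteq> Q2 - N" using perf_diff_countable[OF Q2(1)] by blast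
    have reach: "reach (longer (L t) u) X2 xs"
      if t: "t \<in> P" and xs: "xs \<in> lists Evec" and L: "L t xs u" for t xs u
    proof -
      have pJ: "(xs, u) \<in> J" using xs by (simp add: J_def)
      have t2: "t \<in> Q2" "t \<notin> N" using t P(2) by auto
      obtain I where I: "open I" "t \<in> I" "E (xs, u) (Q2 \<inter> I) X2"
        using bspec[OF bspec[OF dec2 pJ] t2(1)] by (elim exE conjE)
      have "\<not> I_wins f xs u (Q2 \<inter> I) X2"
        using L_never[OF L Q2 X2 I(1) t2(1) I(2)] .
      then have "countable {s\<in>Q2 \<inter> I. \<not> R (xs, u) s}"
        using I(3) by (simp add: E_def reach_ae_def R_def)
      then have "R (xs, u) t" using t2 pJ I(1,2) unfolding N_def by blast
      then show ?thesis by (simp add: R_def)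
    qed
    have "\<forall>t\<in>P. \<exists>L. L [] [] \<and> (\<forall>xs\<in>lists Evec. \<forall>u. L xs u \<longrightarrow> reach (longer L u) X2 xs) \<and>
       (\<forall>xs u. L xs u \<longrightarrow> live_at f t xs u)"
    proof
      fix t assume t: "t \<in> P"
      then have "t \<in> Q2" "t \<in> Q1" using P(2) Q2(2) by auto
      then show "\<exists>L. L [] [] \<and> (\<forall>xs\<in>lists Evec. \<forall>u. L xs u \<longrightarrow> reach (longer L u) X2 xs) \<and>
         (\<forall>xs u. L xs u \<longrightarrow> live_at f t xs u)"
        using start reach[OF t] L_live by (intro exI[of _ "L t"]) simp
    qed
    then show ?thesis using P(1) X2(1) by (intro exI[of _ P] exI[of _ X2] conjI disjI2)
  qed
qed

section \<open>The strategy of player II\<close>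

text \<open>Legality of the answers is demanded only up to the stage at which \<open>T\<close> is
  met; afterwards \<open>\<rho>\<close> may answer anything.\<close>

definition reach_strat ::
  "((nat \<Rightarrow> 'f::field) list \<Rightarrow> bool) \<Rightarrow> (nat \<Rightarrow> nat \<Rightarrow> 'f) \<Rightarrow> (nat \<Rightarrow> 'f) list \<Rightarrow>
    ((nat \<Rightarrow> nat \<Rightarrow> 'f) list \<Rightarrow> nat \<Rightarrow> 'f) \<Rightarrow> bool" where
  "reach_strat T X xs \<rho> \<longleftrightarrow> (\<forall>Ws. (\<forall>k. Ws k \<in> BlockSeqs \<and> alm (Ws k) X) \<longrightarrow>
     (\<exists>k. (\<forall>i<k. \<rho> (map Ws [0..<Suc i]) \<in> bspan (Ws i) \<and> \<rho> (map Ws [0..<Suc i]) \<noteq> 0) \<and>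
       T (xs @ map (\<lambda>i. \<rho> (map Ws [0..<Suc i])) [0..<k])))"

lemma map_upt_Suc_shift: "map f [0..<Suc i] = f 0 # map (\<lambda>j. f (Suc j)) [0..<i]"
  by (simp add: map_upt_Suc del: upt_Suc)

text \<open>Induction on the derivation of \<open>reach\<close>: an answer and a strategy for the
  remaining game are chosen for each possible first move of I.\<close>

lemma reach_strat_exists: "reach T X xs \<Longrightarrow> \<exists>\<rho>. reach_strat T X xs \<rho>"
proof (induction rule: reach.induct)
  case (reach_now xs)
  then show ?case unfolding reach_strat_def by (intro exI allI impI exI[of _ 0]) simp
next
  case (reach_step xs)
  have "\<exists>y \<rho>. W \<in> BlockSeqs \<longrightarrow> alm W X \<longrightarrow> y \<in> bspan W \<and> y \<noteq> 0 \<and> reach_strat T X (xs @ [y]) \<rho>" for W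
  proof (cases "W \<in> BlockSeqs \<and> alm W X")
    case True
    then obtain y \<rho> where "y \<in> bspan W" "y \<noteq> 0" "reach_strat T X (xs @ [y]) \<rho>"
      using reach_step by auto
    then show ?thesis by (intro exI[of _ y] exI[of _ \<rho>]) simp
  qed simp
  then have "\<forall>W. \<exists>y \<rho>. W \<in> BlockSeqs \<longrightarrow> alm W X \<longrightarrow> y \<in> bspan W \<and> y \<noteq> 0 \<and> reach_strat T X (xs @ [y]) \<rho>"
    by (rule allI)
  then obtain y r where yr: "\<forall>W. W \<in> BlockSeqs \<longrightarrow> alm W X \<longrightarrow>
      y W \<in> bspan W \<and> y W \<noteq> 0 \<and> reach_strat T X (xs @ [y W]) (r W)"
    unfolding choice_iff by (elim exE)
  \<comment> \<open>An empty tail marks the first turn; later turns drop the first move, which has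
    selected the strategy \<open>r\<close>.\<close>
  define \<rho> where "\<rho> Vs = (if tl Vs = [] then y (hd Vs) else r (hd Vs) (tl Vs))" for Vs
  have "reach_strat T X xs \<rho>"
    unfolding reach_strat_def
  proof (intro allI impI)
    fix Ws :: "nat \<Rightarrow> nat \<Rightarrow> nat \<Rightarrow> 'a"
    assume Ws: "\<forall>k. Ws k \<in> BlockSeqs \<and> alm (Ws k) X"
    let ?Vs = "\<lambda>i. Ws (Suc i)" and ?r = "r (Ws 0)"
    have y: "y (Ws 0) \<in> bspan (Ws 0)" "y (Ws 0) \<noteq> 0" "reach_strat T X (xs @ [y (Ws 0)]) ?r"
      using yr Ws by blast+
    have Vs: "\<forall>k. ?Vs k \<in> BlockSeqs \<and> alm (?Vs k) X" using Ws by simp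
    obtain k where k: "\<forall>i<k. ?r (map ?Vs [0..<Suc i]) \<in> bspan (?Vs i) \<and> ?r (map ?Vs [0..<Suc i]) \<noteq> 0"
      "T ((xs @ [y (Ws 0)]) @ map (\<lambda>i. ?r (map ?Vs [0..<Suc i])) [0..<k])"
      using mp[OF spec[OF y(3)[unfolded reach_strat_def], of ?Vs] Vs] by (elim exE conjE)
    have \<rho>0: "\<rho> (map Ws [0..<Suc 0]) = y (Ws 0)" by (simp add: \<rho>_def)
    have \<rho>S: "\<rho> (map Ws [0..<Suc (Suc i)]) = ?r (map ?Vs [0..<Suc i])" for i
      unfolding map_upt_Suc_shift[of Ws "Suc i"] by (simp add: \<rho>_def)
    have "\<forall>i<Suc k. \<rho> (map Ws [0..<Suc i]) \<in> bspan (Ws i) \<and> \<rho> (map Ws [0..<Suc i]) \<noteq> 0"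
    proof (intro allI impI)
      fix i assume "i < Suc k"
      then show "\<rho> (map Ws [0..<Suc i]) \<in> bspan (Ws i) \<and> \<rho> (map Ws [0..<Suc i]) \<noteq> 0"
        using y(1,2) \<rho>0 \<rho>S k(1) by (cases i) (simp_all del: upt_Suc)
    qed
    moreover have "xs @ map (\<lambda>i. \<rho> (map Ws [0..<Suc i])) [0..<Suc k] =
        (xs @ [y (Ws 0)]) @ map (\<lambda>i. ?r (map ?Vs [0..<Suc i])) [0..<k]"
      unfolding map_upt_Suc_shift[of "\<lambda>i. \<rho> (map Ws [0..<Suc i])" k] \<rho>0 \<rho>S by simp
    ultimately show "\<exists>k. (\<forall>i<k. \<rho> (map Ws [0..<Suc i]) \<in> bspan (Ws i) \<and> \<rho> (map Ws [0..<Suc i]) \<noteq> 0) \<and>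
       T (xs @ map (\<lambda>i. \<rho> (map Ws [0..<Suc i])) [0..<k])"
      using k(2) by (intro exI[of _ "Suc k"] conjI) simp_all
  qed
  then show ?case by (intro exI[of _ \<rho>])
qed

text \<open>Since \<open>T\<close> fails at \<open>xs\<close>, the stage at which it is met is not
  0, so the first answer is legal and the residual strategy still reaches \<open>T\<close>.\<close>

lemma reach_strat_move:
  assumes "reach_strat T X xs \<rho>" "\<not> T xs" "W \<in> BlockSeqs" "alm W X"
  shows "\<rho> [W] \<in> bspan W" "\<rho> [W] \<noteq> 0" "reach_strat T X (xs @ [\<rho> [W]]) (\<lambda>Vs. \<rho> (W # Vs))"
proof -
  have *: "\<exists>k. (\<forall>i<Suc k. \<rho> (map (case_nat W Vs) [0..<Suc i]) \<in> bspan (case_nat W Vs i) \<and>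
          \<rho> (map (case_nat W Vs) [0..<Suc i]) \<noteq> 0) \<and>
       T (xs @ map (\<lambda>i. \<rho> (map (case_nat W Vs) [0..<Suc i])) [0..<Suc k])"
    if Vs: "\<forall>k. Vs k \<in> BlockSeqs \<and> alm (Vs k) X" for Vs
  proof -
    have "\<forall>k. case_nat W Vs k \<in> BlockSeqs \<and> alm (case_nat W Vs k) X"
      using Vs assms(3,4) by (simp split: nat.split)
    from mp[OF spec[OF assms(1)[unfolded reach_strat_def], of "case_nat W Vs"] this]
    obtain k where k: "\<forall>i<k. \<rho> (map (case_nat W Vs) [0..<Suc i]) \<in> bspan (case_nat W Vs i) \<and>
          \<rho> (map (case_nat W Vs) [0..<Suc i]) \<noteq> 0"
       "T (xs @ map (\<lambda>i. \<rho> (map (case_nat W Vs) [0..<Suc i])) [0..<k])"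
      by (elim exE conjE)
    from k(2) assms(2) obtain l where "k = Suc l" by (cases k) auto
    with k show ?thesis by (intro exI[of _ l] conjI) (simp_all only:)
  qed
  obtain k where "\<forall>i<Suc k. \<rho> (map (case_nat W (\<lambda>_. W)) [0..<Suc i]) \<in> bspan (case_nat W (\<lambda>_. W) i) \<and>
          \<rho> (map (case_nat W (\<lambda>_. W)) [0..<Suc i]) \<noteq> 0"
    using *[of "\<lambda>_. W"] assms(3,4) by auto
  from this[rule_format, of 0] show "\<rho> [W] \<in> bspan W" "\<rho> [W] \<noteq> 0" by auto
  show "reach_strat T X (xs @ [\<rho> [W]]) (\<lambda>Vs. \<rho> (W # Vs))"
    unfolding reach_strat_def
  proof (intro allI impI)
    fix Vs :: "nat \<Rightarrow> nat \<Rightarrow> nat \<Rightarrow> 'a"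
    assume Vs: "\<forall>k. Vs k \<in> BlockSeqs \<and> alm (Vs k) X"
    obtain k where k: "\<forall>i<Suc k. \<rho> (map (case_nat W Vs) [0..<Suc i]) \<in> bspan (case_nat W Vs i) \<and>
          \<rho> (map (case_nat W Vs) [0..<Suc i]) \<noteq> 0"
       "T (xs @ map (\<lambda>i. \<rho> (map (case_nat W Vs) [0..<Suc i])) [0..<Suc k])"
      using *[OF Vs] by (elim exE conjE)
    have eq: "map (case_nat W Vs) [0..<Suc i] = W # map Vs [0..<i]" for i
      unfolding map_upt_Suc_shift by simp
    have "\<forall>i<k. \<rho> (W # map Vs [0..<Suc i]) \<in> bspan (Vs i) \<and> \<rho> (W # map Vs [0..<Suc i]) \<noteq> 0"
    proof (intro allI impI)
      fix i assume "i < k"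
      then show "\<rho> (W # map Vs [0..<Suc i]) \<in> bspan (Vs i) \<and> \<rho> (W # map Vs [0..<Suc i]) \<noteq> 0"
        using k(1)[rule_format, of "Suc i"] unfolding eq by (simp del: upt_Suc)
    qed
    moreover have "T ((xs @ [\<rho> [W]]) @ map (\<lambda>i. \<rho> (W # map Vs [0..<Suc i])) [0..<k])"
      using k(2) unfolding eq map_upt_Suc_shift[of _ k] by (simp del: upt_Suc)
    ultimately show "\<exists>k. (\<forall>i<k. \<rho> (W # map Vs [0..<Suc i]) \<in> bspan (Vs i) \<and> \<rho> (W # map Vs [0..<Suc i]) \<noteq> 0) \<and>
       T ((xs @ [\<rho> [W]]) @ map (\<lambda>i. \<rho> (W # map Vs [0..<Suc i])) [0..<k])"
      by (intro exI[of _ k] conjI)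
  qed
qed

text \<open>A state consists of the position, the digits of the witness announced so far and a strategy
  for reaching a position at which the next digit can be announced.\<close>

lemma II_strategy:
  fixes X :: "nat \<Rightarrow> nat \<Rightarrow> 'f::field" and L :: "(nat \<Rightarrow> 'f) list \<Rightarrow> nat list \<Rightarrow> bool"
  assumes X: "X \<in> BlockSeqs" and L0: "L [] []"
    and reach: "\<forall>xs\<in>lists Evec. \<forall>u. L xs u \<longrightarrow> reach (longer L u) X xs"
  shows "\<exists>\<tau>. \<forall>Ys. (\<forall>k. Ys k \<in> BlockSeqs \<and> below (Ys k) X) \<longrightarrow>
    (let y = (\<lambda>k. \<tau> (map Ys [0..<Suc k])) in
      (\<forall>k. y k \<in> bspan (Ys k) \<and> y k \<noteq> 0) \<and> y \<in> BlockSeqs \<and>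
      (\<exists>U. (\<forall>k. \<exists>w. U (Suc k) = U k @ w) \<and>
        (\<forall>n. \<exists>k\<ge>n. n \<le> length (U k) \<and> L (map y [0..<k]) (U k))))"
proof -
  define inv where "inv = (\<lambda>(xs, u, \<rho>). xs \<in> lists Evec \<and> reach_strat (longer L u) X xs \<rho>)"
  \<comment> \<open>Digits are announced as long as possible; each one shortens the gap between
    \<open>length u\<close> and \<open>length xs\<close>, so this stops.\<close>
  have extend: "\<exists>w \<rho>. L xs (u @ w) \<and> \<not> longer L (u @ w) xs \<and> reach_strat (longer L (u @ w)) X xs \<rho>"
    if xs: "xs \<in> lists Evec" and u: "L xs u" for xs u
    using u
  proof (induction "length xs - length u" arbitrary: u rule: less_induct)
    case less
    show ?case
    proof (cases "longer L u xs")
      case True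
      then obtain m where m: "length u < length xs" "L xs (u @ [m])"
        unfolding longer_def by blast
      have "length xs - length (u @ [m]) < length xs - length u" using m(1) by simp
      from less.hyps[OF this m(2)]
      obtain w \<rho> where "L xs ((u @ [m]) @ w)" "\<not> longer L ((u @ [m]) @ w) xs"
        "reach_strat (longer L ((u @ [m]) @ w)) X xs \<rho>"
        by (elim exE conjE)
      then show ?thesis by (intro exI[of _ "m # w"] exI[of _ \<rho>]) simp
    next
      case False
      obtain \<rho> where "reach_strat (longer L u) X xs \<rho>"
        using reach_strat_exists[OF reach[rule_format, OF xs less.prems]] by (elim exE)
      then show ?thesis using False less.prems by (intro exI[of _ "[]"] exI[of _ \<rho>]) simp
    qed
  qed
  \<comment> \<open>If no digit can be announced, the strategy must stay literally the same: only an
    uninterrupted run of one \<open>\<rho>\<close> is certain to reach its target.\<close>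
  define norm_ok where "norm_ok = (\<lambda>(xs, u, \<rho>) (u', \<rho>'). (\<exists>w. u' = u @ w) \<and>
     \<not> longer L u' xs \<and> reach_strat (longer L u') X xs \<rho>' \<and>
     (if longer L u xs then length u < length u' \<and> L xs u' else u' = u \<and> \<rho>' = \<rho>))"
  have "\<exists>q. inv s \<longrightarrow> norm_ok s q" for s
  proof (cases "inv s")
    case inv: True
    obtain xs u \<rho> where s_eq: "s = (xs, u, \<rho>)" by (cases s)
    show ?thesis
    proof (cases "longer L u xs")
      case True
      have xs: "xs \<in> lists Evec" using inv by (simp add: inv_def s_eq)
      obtain m where "L xs (u @ [m])" using True unfolding longer_def by blast
      from extend[OF xs this] obtain w \<rho>' where "L xs ((u @ [m]) @ w)" "\<not> longer L ((u @ [m]) @ w) xs"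
        "reach_strat (longer L ((u @ [m]) @ w)) X xs \<rho>'"
        by (elim exE conjE)
      then have "norm_ok s ((u @ [m]) @ w, \<rho>')" using True by (simp add: norm_ok_def s_eq)
      then show ?thesis by blast
    next
      case False
      then have "norm_ok s (u, \<rho>)" using inv by (simp add: norm_ok_def s_eq inv_def)
      then show ?thesis by blast
    qed
  qed simp
  then have "\<forall>s. \<exists>q. inv s \<longrightarrow> norm_ok s q" by (rule allI)
  from choice[OF this] obtain norm where norm: "\<forall>s. inv s \<longrightarrow> norm_ok s (norm s)" by (elim exE)
  \<comment> \<open>Answering in a tail of I's move beyond the support of the last vector makes the
    outcome a block sequence; \<open>Suc\<close> is the offset required by
    \<open>bspan_shift_above\<close>.\<close>
  define tail where "tail xs W = shift (Suc (if xs = [] then 0 else Max (supp (last xs)))) W"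
    for xs :: "(nat \<Rightarrow> 'f) list" and W :: "nat \<Rightarrow> nat \<Rightarrow> 'f"
  define turn where "turn = (\<lambda>s W. let V = tail (fst s) W; y = snd (norm s) [V] in
     (fst s @ [y], fst (norm s), (\<lambda>Vs. snd (norm s) (V # Vs))))"
  obtain \<rho>0 where "reach_strat (longer L []) X [] \<rho>0"
    using reach_strat_exists[OF reach[rule_format, OF lists.Nil L0]] by blast
  then have inv0: "inv ([], [], \<rho>0)" using L0 by (simp add: inv_def)
  \<comment> \<open>A strategy sees only the moves of I, so the states are recomputed from the whole
    history.\<close>
  define \<tau> where "\<tau> Ws = last (fst (foldl turn ([], [], \<rho>0) Ws))" for Ws
  show ?thesis
  proof (intro exI[of _ \<tau>] allI impI)
    fix Ys :: "nat \<Rightarrow> nat \<Rightarrow> nat \<Rightarrow> 'f"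
    assume Ys: "\<forall>k. Ys k \<in> BlockSeqs \<and> below (Ys k) X"
    define S where "S k = foldl turn ([], [], \<rho>0) (map Ys [0..<k])" for k
    define xs where "xs k = fst (S k)" for k
    define u where "u k = fst (snd (S k))" for k
    define \<rho> where "\<rho> k = snd (norm (S k))" for k
    define V where "V k = tail (xs k) (Ys k)" for k
    define y where "y k = \<tau> (map Ys [0..<Suc k])" for k
    have S_Suc: "S (Suc k) = (xs k @ [\<rho> k [V k]], fst (norm (S k)), (\<lambda>Vs. \<rho> k (V k # Vs)))" for k
      by (simp add: S_def turn_def Let_def xs_def \<rho>_def V_def)
    have V: "V k \<in> BlockSeqs" "alm (V k) X" "bspan (V k) \<subseteq> bspan (Ys k)" for k
    proof -
      have "below (V k) (Ys k)" by (simp add: V_def tail_def)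
      then show "bspan (V k) \<subseteq> bspan (Ys k)" by (simp add: below_def)
      then show "alm (V k) X" using Ys by (intro below_imp_alm) (auto simp: below_def)
      show "V k \<in> BlockSeqs" using Ys by (simp add: V_def tail_def)
    qed
    have u_Suc: "u (Suc k) = fst (norm (S k))" and xs_Suc: "xs (Suc k) = xs k @ [\<rho> k [V k]]"
      and r_Suc: "snd (snd (S (Suc k))) = (\<lambda>Vs. \<rho> k (V k # Vs))" for k
      by (simp_all add: S_Suc u_def xs_def)
    have y: "y k = \<rho> k [V k]" for k
    proof -
      have "y k = last (fst (S (Suc k)))" by (simp add: y_def \<tau>_def S_def)
      then show ?thesis by (simp add: S_Suc)
    qed
    have xs_eq: "xs k = map y [0..<k]" for k
    proof (induction k)
      case 0
      show ?case by (simp add: xs_def S_def)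
    next
      case (Suc k)
      then show ?case by (simp add: xs_Suc y)
    qed
    have ok: "\<exists>w. u (Suc k) = u k @ w" "\<not> longer L (u (Suc k)) (xs k)"
       "reach_strat (longer L (u (Suc k))) X (xs k) (\<rho> k)"
       "longer L (u k) (xs k) \<Longrightarrow> length (u k) < length (u (Suc k)) \<and> L (xs k) (u (Suc k))"
       "\<not> longer L (u k) (xs k) \<Longrightarrow> u (Suc k) = u k \<and> \<rho> k = snd (snd (S k))"
      if inv: "inv (S k)" for k
    proof -
      have eq: "S k = (xs k, u k, snd (snd (S k)))" "norm (S k) = (u (Suc k), \<rho> k)"
        by (simp_all add: xs_def u_def \<rho>_def S_Suc)
      have "norm_ok (xs k, u k, snd (snd (S k))) (u (Suc k), \<rho> k)"
        using norm inv eq by metis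
      then show "\<exists>w. u (Suc k) = u k @ w" "\<not> longer L (u (Suc k)) (xs k)"
       "reach_strat (longer L (u (Suc k))) X (xs k) (\<rho> k)"
       "longer L (u k) (xs k) \<Longrightarrow> length (u k) < length (u (Suc k)) \<and> L (xs k) (u (Suc k))"
       "\<not> longer L (u k) (xs k) \<Longrightarrow> u (Suc k) = u k \<and> \<rho> k = snd (snd (S k))"
        by (simp_all add: norm_ok_def)
    qed
    have inv: "inv (S k)" for k
    proof (induction k)
      case 0
      show ?case using inv0 by (simp add: S_def)
    next
      case (Suc k)
      note move = reach_strat_move[OF ok(3)[OF Suc] ok(2)[OF Suc] V(1,2)]
      have "\<rho> k [V k] \<in> Evec" using move(1) bspan_Evec[OF V(1)] by blast
      moreover have "xs k \<in> lists Evec" using Suc by (auto simp: inv_def xs_def)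
      ultimately have "xs (Suc k) \<in> lists Evec" by (simp add: xs_Suc)
      moreover have "reach_strat (longer L (u (Suc k))) X (xs (Suc k)) (\<lambda>Vs. \<rho> k (V k # Vs))"
        using move(3) by (simp add: xs_Suc)
      moreover have "S (Suc k) = (xs (Suc k), u (Suc k), (\<lambda>Vs. \<rho> k (V k # Vs)))"
        by (simp add: S_Suc xs_def u_def)
      ultimately show ?case by (simp add: inv_def)
    qed
    have yV: "y k \<in> bspan (V k)" "y k \<noteq> 0" for k
      unfolding y using reach_strat_move[OF ok(3)[OF inv] ok(2)[OF inv] V(1,2)] by blast+
    have yB: "y \<in> BlockSeqs"
      unfolding BlockSeqs_iff
    proof (intro conjI allI)
      fix k
      show "y k \<in> Evec" using yV(1) bspan_Evec[OF V(1)] by blast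
      show "y k \<noteq> 0" by (rule yV)
      have "V (Suc k) = shift (Suc (Max (supp (y k)))) (Ys (Suc k))"
        by (simp add: V_def tail_def xs_eq)
      then show "above (Max (supp (y k))) (y (Suc k))"
        using bspan_shift_above[of "Ys (Suc k)"] yV(1)[of "Suc k"] Ys by simp
    qed
    \<comment> \<open>Otherwise one strategy \<open>\<rho> k\<close> with the fixed digits
      \<open>u k\<close> would be run forever from \<open>xs k\<close>, and it must reach its target
      after finitely many moves.\<close>
    have change: "\<exists>j\<ge>k. longer L (u j) (xs j)" for k
    proof (rule ccontr)
      assume "\<not> ?thesis"
      then have no: "\<not> longer L (u (k + i)) (xs (k + i))" for i by simp
      let ?Ws = "\<lambda>i. V (k + i)"
      have const: "u (k + i) = u k" for i
      proof (induction i)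
        case (Suc i)
        then show ?case using ok(5)[OF inv no[of i]] by simp
      qed simp
      have run: "\<rho> (k + i) = (\<lambda>Vs. \<rho> k (map ?Ws [0..<i] @ Vs))" for i
      proof (induction i)
        case (Suc i)
        have "\<rho> (k + Suc i) = (\<lambda>Vs. \<rho> (k + i) (V (k + i) # Vs))"
          using ok(5)[OF inv no[of "Suc i"]] r_Suc[of "k + i"] by simp
        then show ?case by (simp add: Suc)
      qed simp
      have pos: "xs (k + i) = xs k @ map (\<lambda>i. \<rho> k (map ?Ws [0..<Suc i])) [0..<i]" for i
      proof (induction i)
        case (Suc i)
        have "xs (k + Suc i) = xs (k + i) @ [\<rho> (k + i) [V (k + i)]]" by (simp add: xs_Suc)
        also have "\<rho> (k + i) [V (k + i)] = \<rho> k (map ?Ws [0..<Suc i])" by (simp add: run)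
        finally show ?case by (simp add: Suc)
      qed simp
      have rs: "reach_strat (longer L (u k)) X (xs k) (\<rho> k)"
        using ok(3)[OF inv, of k] const[of 1] by simp
      have "\<forall>i. ?Ws i \<in> BlockSeqs \<and> alm (?Ws i) X" using V by blast
      from mp[OF spec[OF rs[unfolded reach_strat_def], of ?Ws] this]
      obtain n where "longer L (u k) (xs k @ map (\<lambda>i. \<rho> k (map ?Ws [0..<Suc i])) [0..<n])"
        by (elim exE conjE)
      then have "longer L (u (k + n)) (xs (k + n))" by (simp only: const pos)
      then show False using no by blast
    qed
    have grow: "length (u j) \<le> length (u k)" if "j \<le> k" for j k
    proof (rule lift_Suc_mono_le[of "\<lambda>k. length (u k)", OF _ that])
      show "length (u n) \<le> length (u (Suc n))" for n using ok(1)[OF inv, of n] by auto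
    qed
    have long: "\<exists>k. n \<le> length (u k)" for n
    proof (induction n)
      case (Suc n)
      then obtain k where k: "n \<le> length (u k)" by blast
      obtain j where j: "j \<ge> k" "longer L (u j) (xs j)" using change by blast
      have "n < length (u (Suc j))" using ok(4)[OF inv j(2)] grow[OF j(1)] k by linarith
      then show ?case by (intro exI[of _ "Suc j"]) simp
    qed simp
    have live: "\<exists>k\<ge>n. n \<le> length (u (Suc k)) \<and> L (map y [0..<k]) (u (Suc k))" for n
    proof -
      obtain k where k: "n \<le> length (u k)" using long by blast
      obtain j where j: "j \<ge> max n k" "longer L (u j) (xs j)" using change by blast
      have "n \<le> length (u (Suc j))" using grow[of k "Suc j"] j(1) k by simp
      then show ?thesis using ok(4)[OF inv j(2)] j(1) by (auto simp: xs_eq)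
    qed
    have "\<forall>k. y k \<in> bspan (Ys k) \<and> y k \<noteq> 0" using yV V(3) by blast
    moreover have "\<exists>U. (\<forall>k. \<exists>w. U (Suc k) = U k @ w) \<and>
        (\<forall>n. \<exists>k\<ge>n. n \<le> length (U k) \<and> L (map y [0..<k]) (U k))"
      using ok(1)[OF inv] live by (intro exI[of _ "\<lambda>k. u (Suc k)"]) simp
    ultimately have "(\<forall>k. y k \<in> bspan (Ys k) \<and> y k \<noteq> 0) \<and> y \<in> BlockSeqs \<and>
      (\<exists>U. (\<forall>k. \<exists>w. U (Suc k) = U k @ w) \<and>
        (\<forall>n. \<exists>k\<ge>n. n \<le> length (U k) \<and> L (map y [0..<k]) (U k)))"
      using yB by (intro conjI)
    moreover have "y = (\<lambda>k. \<tau> (map Ys [0..<Suc k]))" by (rule ext) (rule y_def)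
    ultimately show "let y = (\<lambda>k. \<tau> (map Ys [0..<Suc k])) in
      (\<forall>k. y k \<in> bspan (Ys k) \<and> y k \<noteq> 0) \<and> y \<in> BlockSeqs \<and>
      (\<exists>U. (\<forall>k. \<exists>w. U (Suc k) = U k @ w) \<and>
        (\<forall>n. \<exists>k\<ge>n. n \<le> length (U k) \<and> L (map y [0..<k]) (U k)))"
      unfolding Let_def by metis
  qed
qed

section \<open>The theorem\<close>

lemma openin_baire_cylinder:
  assumes "openin baire_top U" "b \<in> U"
  shows "\<exists>n. \<forall>b'. (\<forall>i<n. b' i = b i) \<longrightarrow> b' \<in> U"
proof -
  obtain V where V: "b \<in> (\<Pi>\<^sub>E i\<in>UNIV. V i)" "finite {i. V i \<noteq> UNIV}" "(\<Pi>\<^sub>E i\<in>UNIV. V i) \<subseteq> U"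
    using product_topology_open_contains_basis[OF assms(1)[unfolded baire_top_def] assms(2)] by auto
  obtain n where n: "\<And>i. V i \<noteq> UNIV \<Longrightarrow> i < n"
    using V(2) finite_nat_set_iff_bounded[of "{i. V i \<noteq> UNIV}"] by auto
  have "b' \<in> U" if b': "\<forall>i<n. b' i = b i" for b'
  proof -
    have "b' i \<in> V i" for i
    proof (cases "i < n")
      case True
      then show ?thesis using V(1) b' by (auto simp: PiE_iff)
    next
      case False
      then have "V i = UNIV" using n[of i] by auto
      then show ?thesis by simp
    qed
    then show ?thesis using V(3) by (auto simp: PiE_iff)
  qed
  then show ?thesis by blast
qed

lemma continuous_coding:
  fixes f :: "(nat \<Rightarrow> nat) \<Rightarrow> real \<times> (nat \<Rightarrow> nat \<Rightarrow> 'f::zero)"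
  assumes f: "continuous_map baire_top (prod_topology euclideanreal block_top) f"
  shows "e > 0 \<Longrightarrow> \<exists>n. \<forall>b'. (\<forall>i<n. b' i = b i) \<longrightarrow> dist (fst (f b')) (fst (f b)) < e"
    and "\<exists>n. \<forall>b'. (\<forall>i<n. b' i = b i) \<longrightarrow> snd (f b') j = snd (f b) j"
proof -
  have top: "topspace baire_top = UNIV" by (simp add: baire_top_def)
  have f1: "continuous_map baire_top euclideanreal (fst \<circ> f)"
    and f2: "continuous_map baire_top block_top (snd \<circ> f)"
    using f by (simp_all add: continuous_map_pairwise)
  show "\<exists>n. \<forall>b'. (\<forall>i<n. b' i = b i) \<longrightarrow> dist (fst (f b')) (fst (f b)) < e" if "e > 0"
  proof -
    have "openin baire_top {b'. (fst \<circ> f) b' \<in> ball (fst (f b)) e}"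
      using openin_continuous_map_preimage[OF f1, of "ball (fst (f b)) e"] by (simp add: top)
    from openin_baire_cylinder[OF this, of b] that show ?thesis
      by (simp add: dist_commute)
  qed
  have f3: "continuous_map baire_top (product_topology (\<lambda>_. discrete_topology Evec) UNIV) (snd \<circ> f)"
    using f2 by (simp add: block_top_def continuous_map_in_subtopology)
  then have f4: "continuous_map baire_top (discrete_topology Evec) (\<lambda>b. (snd \<circ> f) b j)"
    by (simp only: continuous_map_componentwise_UNIV)
  have "snd (f b) j \<in> Evec"
    using continuous_map_funspace[OF f4] by (auto simp: top)
  then have "openin baire_top {b'. (snd \<circ> f) b' j \<in> {snd (f b) j}}"
    using openin_continuous_map_preimage[OF f4, of "{snd (f b) j}"] by (simp add: top)
  from openin_baire_cylinder[OF this, of b]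
  show "\<exists>n. \<forall>b'. (\<forall>i<n. b' i = b i) \<longrightarrow> snd (f b') j = snd (f b) j" by simp
qed

text \<open>The strings \<open>U k\<close> are the initial segments of one \<open>b\<close>. By
  liveness there are \<open>b'\<close> sharing any prescribed number of digits with \<open>b\<close>
  such that \<open>f b'\<close> is close to \<open>t\<close> and agrees with \<open>y\<close> on
  many coordinates; continuity gives \<open>f b = (t, y)\<close>.\<close>

lemma live_limit:
  fixes f :: "(nat \<Rightarrow> nat) \<Rightarrow> real \<times> (nat \<Rightarrow> nat \<Rightarrow> 'f::field)"
  assumes f: "continuous_map baire_top (prod_topology euclideanreal block_top) f"
    and ext: "\<And>k. \<exists>w. U (Suc k) = U k @ w"
    and live: "\<And>n. \<exists>k\<ge>n. n \<le> length (U k) \<and> live_at f t (map y [0..<k]) (U k)"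
  shows "(t, y) \<in> range f"
proof -
  have ext': "\<exists>w. U k = U j @ w" if "j \<le> k" for j k
    using that
  proof (induction k rule: dec_induct)
    case (step k)
    then show ?case using ext[of k] by (metis append_assoc)
  qed simp
  have "\<forall>i. \<exists>k. i < length (U k)" using live[of "Suc _"] by (meson Suc_le_lessD)
  from choice[OF this] obtain g where g: "\<forall>i. i < length (U (g i))" by (elim exE)
  define b where "b i = U (g i) ! i" for i
  have b: "U k ! i = b i" if "i < length (U k)" for k i
  proof (cases "k \<le> g i")
    case True
    then show ?thesis using ext'[OF True] that by (auto simp: b_def nth_append)
  next
    case False
    then have "g i \<le> k" by simp
    then show ?thesis using ext'[of "g i" k] g[rule_format, of i] by (auto simp: b_def nth_append)
  qed
  have near: "\<exists>b'. (\<forall>i<n. b' i = b i) \<and> dist (fst (f b')) t < e \<and> (\<forall>i<n. snd (f b') i = y i)"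
    if "e > 0" for n e
  proof -
    obtain k where k: "k \<ge> n" "n \<le> length (U k)" "live_at f t (map y [0..<k]) (U k)"
      using live by blast
    obtain b' where b': "map b' [0..<length (U k)] = U k" "fst (f b') \<in> ball t e"
      "map (snd (f b')) [0..<length (map y [0..<k])] = map y [0..<k]"
      using k(3) \<open>e > 0\<close> unfolding live_at_def by (metis centre_in_ball open_ball)
    have "b' i = b i" if "i < n" for i
      using arg_cong[OF b'(1), of "\<lambda>l. l ! i"] b[of i k] that k(2) by simp
    moreover have "snd (f b') i = y i" if "i < n" for i
      using arg_cong[OF b'(3), of "\<lambda>l. l ! i"] that k(1) by simp
    ultimately show ?thesis using b'(2) by (intro exI[of _ b']) (simp add: dist_commute)
  qed
  have "fst (f b) = t"
  proof (rule ccontr)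
    assume "fst (f b) \<noteq> t"
    then have e: "dist (fst (f b)) t / 2 > 0" by simp
    obtain n where n: "\<forall>b'. (\<forall>i<n. b' i = b i) \<longrightarrow> dist (fst (f b')) (fst (f b)) < dist (fst (f b)) t / 2"
      using continuous_coding(1)[OF f e, of b] by (elim exE)
    obtain b' where b': "\<forall>i<n. b' i = b i" "dist (fst (f b')) t < dist (fst (f b)) t / 2"
      using near[OF e, of n] by (elim exE conjE)
    have "dist (fst (f b')) (fst (f b)) < dist (fst (f b)) t / 2"
      using b'(1) by (rule mp[OF spec[OF n]])
    then have "dist (fst (f b)) t < dist (fst (f b)) t"
      using b'(2) by (rule dist_triangle_half_r)
    then show False by simp
  qed
  moreover have "snd (f b) = y"
  proof
    fix j
    obtain n where n: "\<forall>b'. (\<forall>i<n. b' i = b i) \<longrightarrow> snd (f b') j = snd (f b) j"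
      using continuous_coding(2)[OF f, of b j] by (elim exE)
    obtain b' where b': "\<forall>i<max n (Suc j). b' i = b i" "\<forall>i<max n (Suc j). snd (f b') i = y i"
      using near[OF zero_less_one, of "max n (Suc j)"] by (elim exE conjE)
    have "snd (f b') j = y j" using b'(2) by simp
    moreover have "\<forall>i<n. b' i = b i" using b'(1) by simp
    then have "snd (f b') j = snd (f b) j" by (rule mp[OF spec[OF n]])
    ultimately show "snd (f b) j = y j" by simp
  qed
  ultimately have "(t, y) = f b" by (metis prod.collapse)
  then show ?thesis by (intro image_eqI[of _ _ b]) simp_all
qed

lemma perf_imp_perfect_real: "perf P \<Longrightarrow> P \<noteq> {} \<and> perfect_real P"
  by (auto simp: perf_def perfect_real_def compact_imp_closed)

theorem theorem1p7:
  fixes A :: "(real \<times> (nat \<Rightarrow> nat \<Rightarrow> 'f::{field,countable})) set"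
  assumes "A \<subseteq> UNIV \<times> BlockSeqs"
    and "analytic_in (prod_topology euclideanreal block_top) A"
  shows "\<exists>P X. P \<noteq> {} \<and> perfect_real P \<and> X \<in> BlockSeqs \<and>
     ((\<exists>\<sigma>. P \<times> asym_outcomes X \<sigma> \<subseteq> (UNIV \<times> BlockSeqs) - A) \<or>
      (\<forall>t\<in>P. \<exists>\<tau>. gowers_II_into X \<tau> {Y \<in> BlockSeqs. (t, Y) \<in> A}))"
proof (cases "A = {}")
  case True
  \<comment> \<open>The empty set is no continuous image of Baire space, so it has no code
    \<open>f\<close>; here the constant strategy 0 of I suffices.\<close>
  obtain X :: "nat \<Rightarrow> nat \<Rightarrow> 'f" where "X \<in> BlockSeqs" using BlockSeqs_nonempty by blast
  moreover have "{0..1} \<times> asym_outcomes X (\<lambda>_. 0) \<subseteq> (UNIV \<times> BlockSeqs) - A"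
    using True by (auto simp: asym_outcomes_def)
  ultimately show ?thesis using perf_imp_perfect_real[OF perf_Icc] by blast
next
  case False
  then obtain f where f: "continuous_map baire_top (prod_topology euclideanreal block_top) f"
    and A: "range f = A"
    using assms(2) by (auto simp: analytic_in_def)
  obtain P X where P: "perf P" and X: "X \<in> BlockSeqs" and alt: "I_wins f [] [] P X \<or>
    (\<forall>t\<in>P. \<exists>L. L [] [] \<and> (\<forall>xs\<in>lists Evec. \<forall>u. L xs u \<longrightarrow> reach (longer L u) X xs) \<and>
       (\<forall>xs u. L xs u \<longrightarrow> live_at f t xs u))"
    using unfolded_dichotomy[of f] by (elim exE conjE)
  from alt have "(\<exists>\<sigma>. P \<times> asym_outcomes X \<sigma> \<subseteq> (UNIV \<times> BlockSeqs) - A) \<or>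
      (\<forall>t\<in>P. \<exists>\<tau>. gowers_II_into X \<tau> {Y \<in> BlockSeqs. (t, Y) \<in> A})"
  proof
    assume "I_wins f [] [] P X"
    then obtain \<sigma> where \<sigma>: "\<forall>x. follows X \<sigma> [] x \<longrightarrow> (\<forall>t\<in>P. \<forall>b. f b \<noteq> (t, x))"
      unfolding I_wins_def by auto
    have "P \<times> asym_outcomes X \<sigma> \<subseteq> (UNIV \<times> BlockSeqs) - A"
    proof
      fix p assume "p \<in> P \<times> asym_outcomes X \<sigma>"
      then obtain t x where p: "p = (t, x)" "t \<in> P" "x \<in> asym_outcomes X \<sigma>" by blast
      then have x: "x \<in> BlockSeqs" "\<forall>k. x k \<in> bspan X \<and> \<sigma> (map x [0..<k]) < Min (supp (x k))"
        by (auto simp: asym_outcomes_def)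
      then have "follows X \<sigma> [] x"
        using BlockSeqsD(1,2)[OF x(1)] by (simp add: follows_def above_iff_less_Min)
      then have "f b \<noteq> (t, x)" for b using \<sigma> p(2) by blast
      then have "(t, x) \<notin> range f" unfolding image_iff by (metis (lifting))
      then show "p \<in> (UNIV \<times> BlockSeqs) - A" using A p(1) x(1) by simp
    qed
    then show ?thesis by blast
  next
    assume II: "\<forall>t\<in>P. \<exists>L. L [] [] \<and> (\<forall>xs\<in>lists Evec. \<forall>u. L xs u \<longrightarrow> reach (longer L u) X xs) \<and>
       (\<forall>xs u. L xs u \<longrightarrow> live_at f t xs u)"
    have "\<exists>\<tau>. gowers_II_into X \<tau> {Y \<in> BlockSeqs. (t, Y) \<in> A}" if t: "t \<in> P" for t
    proof -
      obtain L where L: "L [] []" "\<forall>xs\<in>lists Evec. \<forall>u. L xs u \<longrightarrow> reach (longer L u) X xs"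
        "\<forall>xs u. L xs u \<longrightarrow> live_at f t xs u"
        using bspec[OF II t] by (elim exE conjE)
      obtain \<tau> where \<tau>: "\<forall>Ys. (\<forall>k. Ys k \<in> BlockSeqs \<and> below (Ys k) X) \<longrightarrow>
        (let y = (\<lambda>k. \<tau> (map Ys [0..<Suc k])) in
          (\<forall>k. y k \<in> bspan (Ys k) \<and> y k \<noteq> 0) \<and> y \<in> BlockSeqs \<and>
          (\<exists>U. (\<forall>k. \<exists>w. U (Suc k) = U k @ w) \<and>
            (\<forall>n. \<exists>k\<ge>n. n \<le> length (U k) \<and> L (map y [0..<k]) (U k))))"
        using II_strategy[OF X L(1,2)] by (elim exE)
      have "gowers_II_into X \<tau> {Y \<in> BlockSeqs. (t, Y) \<in> A}"
        unfolding gowers_II_into_def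
      proof (intro allI impI)
        fix Ys :: "nat \<Rightarrow> nat \<Rightarrow> nat \<Rightarrow> 'f"
        assume Ys: "\<forall>k. Ys k \<in> BlockSeqs \<and> below (Ys k) X"
        define y where "y = (\<lambda>k. \<tau> (map Ys [0..<Suc k]))"
        have y: "(\<forall>k. y k \<in> bspan (Ys k) \<and> y k \<noteq> 0) \<and> y \<in> BlockSeqs \<and>
          (\<exists>U. (\<forall>k. \<exists>w. U (Suc k) = U k @ w) \<and>
            (\<forall>n. \<exists>k\<ge>n. n \<le> length (U k) \<and> L (map y [0..<k]) (U k)))"
          using mp[OF spec[OF \<tau>] Ys] unfolding Let_def y_def .
        then obtain U where U: "\<forall>k. \<exists>w. U (Suc k) = U k @ w"
          "\<forall>n. \<exists>k\<ge>n. n \<le> length (U k) \<and> L (map y [0..<k]) (U k)"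
          by (elim exE conjE)
        have "(t, y) \<in> range f"
        proof (rule live_limit[OF f])
          show "\<exists>w. U (Suc k) = U k @ w" for k using U(1) by (rule spec)
          show "\<exists>k\<ge>n. n \<le> length (U k) \<and> live_at f t (map y [0..<k]) (U k)" for n
            using U(2)[rule_format, of n] L(3) by blast
        qed
        then show "let y = (\<lambda>k. \<tau> (map Ys [0..<Suc k])) in
          (\<forall>k. y k \<in> bspan (Ys k) \<and> y k \<noteq> 0) \<and> y \<in> BlockSeqs \<and>
          y \<in> {Y \<in> BlockSeqs. (t, Y) \<in> A}"
          using y A unfolding Let_def y_def[symmetric] by simp
      qed
      then show ?thesis by (intro exI[of _ \<tau>])
    qed
    then show ?thesis by blast
  qed
  then show ?thesis using perf_imp_perfect_real[OF P] X by (intro exI[of _ P] exI[of _ X]) simp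
qed

end
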